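(* Let $d\in\mathbb N$, $\alpha>1/2$, let $\boldsymbol\gamma=\{\gamma_{\mathfrak u}\}_{\mathfrak u\subset\mathbb N}$ be positive weights, let $n\ge2$ be an integer and let $\boldsymbol z\in\mathbb Z^d$. Then $$ e^{\mathrm{ran}}_{d,\alpha,\boldsymbol\gamma}\big(Q^{\mathrm{ran\text{-}pr}}_{d,n,\boldsymbol z}\big)=\Bigg(\sum_{\boldsymbol h\in\mathbb Z^d\setminus\{\boldsymbol0\}}\omega_n^2(\boldsymbol h,\boldsymbol z)\,r_{\alpha,\boldsymbol\gamma}^{-2}(\boldsymbol h)\Bigg)^{1/2}, $$ where $$\omega_n(\boldsymbol h,\boldsymbol z):=\frac1{|\mathcal P_n|}\sum_{p\in\mathcal P_n}\mathbf 1(\boldsymbol h\cdot\boldsymbol z\equiv_p0).$$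
   Context: Conventions: $\equiv_p$ means congruent modulo $p$; $\mathbf 1(\cdot)$ is the indicator function; $\mathrm{supp}(\boldsymbol h)=\{j:h_j\ne0\}$. Weights: $\boldsymbol\gamma=\{\gamma_{\mathfrak u}\}$ is a collection of positive finite numbers indexed by the finite subsets $\mathfrak u\subset\mathbb N$. Weighted Korobov space: for $\alpha>1/2$ put $r_{\alpha,\boldsymbol\gamma}(\boldsymbol h)=\gamma_{\mathrm{supp}(\boldsymbol h)}^{-1}\prod_{j\in\mathrm{supp}(\boldsymbol h)}|h_j|^\alpha$ and $\widehat f(\boldsymbol h)=\int_{[0,1]^d}f(\boldsymbol x)e^{-2\pi\mathrm i\,\boldsymbol h\cdot\boldsymbol x}\,d\boldsymbol x$. Then $\mathcal H_{d,\alpha,\boldsymbol\gamma}=\{f\in L_2([0,1]^d):\|f\|_{d,\alpha,\boldsymbol\gamma}<\infty\}$ with $\|f\|_{d,\alpha,\boldsymbol\gamma}=(\sum_{\boldsymbol h\in\mathbb Z^d}r^2_{\alpha,\boldsymbol\gamma}(\boldsymbol h)|\widehat f(\boldsymbol h)|^2)^{1/2}$; elements have absolutely convergent Fourier series and are identified with their continuous one-periodic representatives. $I_d(f)=\int_{[0,1]^d}f(\boldsymbol x)\,d\boldsymbol x$; lattice rule $Q_{d,m,\boldsymbol z}(f)=\frac1m\sum_{k=0}^{m-1}f\big(\frac{k\boldsymbol z\bmod m}{m}\big)$. $\mathcal P_n$ is the set of primes $p$ with $n/2<p\le n$. The randomised algorithm $Q^{\mathrm{ran\text{-}pr}}_{d,n,\boldsymbol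 z}$ (fixed $\boldsymbol z$) draws $p$ uniformly at random from $\mathcal P_n$ and returns $Q_{d,p,\boldsymbol z}(f)$. The randomised error of a randomised algorithm $A$ is $e^{\mathrm{ran}}_{d,\alpha,\boldsymbol\gamma}(A)=\sup_{f\in\mathcal H_{d,\alpha,\boldsymbol\gamma},\,\|f\|_{d,\alpha,\boldsymbol\gamma}\le1}\mathbb E[|A(f)-I_d(f)|]$. *)

theory Defs
  imports "HOL-Probability.Probability" "HOL-Number_Theory.Cong"
begin

text \<open>
  Vectors in \<open>\<real>\<^sup>d\<close> and \<open>\<int>\<^sup>d\<close> are extensional functions on the index set \<open>{1..d}\<close>, matching the
  carrier of the product measure \<open>PiM {1..d} M\<close>. The coordinates are natural numbers because the
  weights are indexed by finite sets of natural numbers.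
\<close>

definition real_vecs :: "nat \<Rightarrow> (nat \<Rightarrow> real) set" where
  "real_vecs d = ({1..d} \<rightarrow>\<^sub>E UNIV)"

definition int_vecs :: "nat \<Rightarrow> (nat \<Rightarrow> int) set" where
  "int_vecs d = ({1..d} \<rightarrow>\<^sub>E UNIV)"

definition zero_vec :: "nat \<Rightarrow> nat \<Rightarrow> int" where
  "zero_vec d = (\<lambda>j\<in>{1..d}. 0)"

definition unit_cube :: "nat \<Rightarrow> (nat \<Rightarrow> real) set" where
  "unit_cube d = ({1..d} \<rightarrow>\<^sub>E {0..1})"

definition lebesgue_vecs :: "nat \<Rightarrow> (nat \<Rightarrow> real) measure" where
  "lebesgue_vecs d = PiM {1..d} (\<lambda>_. lborel)"

definition supp :: "nat \<Rightarrow> (nat \<Rightarrow> int) \<Rightarrow> nat set" where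
  "supp d h = {j \<in> {1..d}. h j \<noteq> 0}"

definition positive_weights :: "(nat set \<Rightarrow> real) \<Rightarrow> bool" where
  "positive_weights \<gamma> \<longleftrightarrow> (\<forall>u. finite u \<longrightarrow> \<gamma> u > 0)"

definition korobov_r :: "nat \<Rightarrow> real \<Rightarrow> (nat set \<Rightarrow> real) \<Rightarrow> (nat \<Rightarrow> int) \<Rightarrow> real" where
  "korobov_r d \<alpha> \<gamma> h =
     inverse (\<gamma> (supp d h)) * (\<Prod>j\<in>supp d h. \<bar>real_of_int (h j)\<bar> powr \<alpha>)"

definition cube_integral :: "nat \<Rightarrow> ((nat \<Rightarrow> real) \<Rightarrow> complex) \<Rightarrow> complex" where
  "cube_integral d f = set_lebesgue_integral (lebesgue_vecs d) (unit_cube d) f"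

definition fourier_coeff :: "nat \<Rightarrow> ((nat \<Rightarrow> real) \<Rightarrow> complex) \<Rightarrow> (nat \<Rightarrow> int) \<Rightarrow> complex" where
  "fourier_coeff d f h =
     cube_integral d (\<lambda>x. f x *
       exp (- 2 * of_real pi * \<i> * of_real (\<Sum>j=1..d. real_of_int (h j) * x j)))"

definition square_integrable_cube :: "nat \<Rightarrow> ((nat \<Rightarrow> real) \<Rightarrow> complex) \<Rightarrow> bool" where
  "square_integrable_cube d f \<longleftrightarrow>
     set_borel_measurable (lebesgue_vecs d) (unit_cube d) f \<and>
     set_integrable (lebesgue_vecs d) (unit_cube d) (\<lambda>x. (cmod (f x))\<^sup>2)"

definition one_periodic :: "nat \<Rightarrow> ((nat \<Rightarrow> real) \<Rightarrow> complex) \<Rightarrow> bool" where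
  "one_periodic d f \<longleftrightarrow> (\<forall>x\<in>real_vecs d. \<forall>j\<in>{1..d}. f (x(j := x j + 1)) = f x)"

definition korobov_norm ::
  "nat \<Rightarrow> real \<Rightarrow> (nat set \<Rightarrow> real) \<Rightarrow> ((nat \<Rightarrow> real) \<Rightarrow> complex) \<Rightarrow> real" where
  "korobov_norm d \<alpha> \<gamma> f =
     sqrt (\<Sum>\<^sub>\<infinity>h\<in>int_vecs d. (korobov_r d \<alpha> \<gamma> h)\<^sup>2 * (cmod (fourier_coeff d f h))\<^sup>2)"

text \<open>
  Elements of the space are given by their continuous one-periodic representatives. The topology on
  \<open>nat \<Rightarrow> real\<close> is the product topology, which on \<open>real_vecs d\<close> is the Euclidean one.
  Finiteness of the norm is stated as summability, because an unconditional sum of reals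
  that does not converge has the value 0.
\<close>

definition korobov_space ::
  "nat \<Rightarrow> real \<Rightarrow> (nat set \<Rightarrow> real) \<Rightarrow> ((nat \<Rightarrow> real) \<Rightarrow> complex) set" where
  "korobov_space d \<alpha> \<gamma> =
     {f. continuous_on (real_vecs d) f \<and> one_periodic d f \<and> square_integrable_cube d f \<and>
         (\<lambda>h. (korobov_r d \<alpha> \<gamma> h)\<^sup>2 * (cmod (fourier_coeff d f h))\<^sup>2) summable_on int_vecs d}"

definition lattice_rule ::
  "nat \<Rightarrow> nat \<Rightarrow> (nat \<Rightarrow> int) \<Rightarrow> ((nat \<Rightarrow> real) \<Rightarrow> complex) \<Rightarrow> complex" where
  "lattice_rule d m z f =
     1 / of_nat m *
     (\<Sum>k<m. f (\<lambda>j\<in>{1..d}. real_of_int ((int k * z j) mod int m) / real m))"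

text \<open>
  A randomised algorithm is a probability space together with a deterministic algorithm for each
  outcome.
\<close>

type_synonym 'w randomised_algorithm =
  "'w measure \<times> ('w \<Rightarrow> ((nat \<Rightarrow> real) \<Rightarrow> complex) \<Rightarrow> complex)"

definition randomised_error ::
  "nat \<Rightarrow> real \<Rightarrow> (nat set \<Rightarrow> real) \<Rightarrow> 'w randomised_algorithm \<Rightarrow> ennreal" where
  "randomised_error d \<alpha> \<gamma> A =
     (SUP f\<in>{f \<in> korobov_space d \<alpha> \<gamma>. korobov_norm d \<alpha> \<gamma> f \<le> 1}.
        \<integral>\<^sup>+\<omega>. ennreal (cmod (snd A \<omega> f - cube_integral d f)) \<partial>fst A)"

definition prime_range :: "nat \<Rightarrow> nat set" where
  "prime_range n = {p. prime p \<and> real n / 2 < real p \<and> p \<le> n}"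

definition ran_prime_rule :: "nat \<Rightarrow> nat \<Rightarrow> (nat \<Rightarrow> int) \<Rightarrow> nat randomised_algorithm" where
  "ran_prime_rule d n z = (uniform_count_measure (prime_range n), \<lambda>p. lattice_rule d p z)"

definition omega :: "nat \<Rightarrow> nat \<Rightarrow> (nat \<Rightarrow> int) \<Rightarrow> (nat \<Rightarrow> int) \<Rightarrow> real" where
  "omega d n h z =
     1 / real (card (prime_range n)) *
     (\<Sum>p\<in>prime_range n. of_bool ([(\<Sum>j=1..d. h j * z j) = 0] (mod int p)))"

end

theory Submission
  imports Defs
begin

text \<open>
  Averaging a harmonic \<open>exp (2 \<pi> i h \<cdot> x)\<close> over the \<open>p\<close> nodes of a lattice rule gives
  \<open>1\<close> if \<open>h \<cdot> z\<close> vanishes modulo \<open>p\<close> and \<open>0\<close> otherwise, so the error of the rule is the sum of the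
  Fourier coefficients over the nonzero \<open>h\<close> of the dual lattice. The triangle inequality turns the
  mean over \<open>p\<close> into a sum with weights \<open>\<omega>\<^sub>n(h, z)\<close>, which Cauchy-Schwarz bounds by
  the norm; equality holds for the function with coefficients proportional to
  \<open>\<omega>\<^sub>n(h, z) r(h)\<^sup>-\<^sup>2\<close>, because they are nonnegative.

  Pointwise Fourier inversion rests on the fact that a continuous function with vanishing Fourier
  coefficients is zero: it is orthogonal to all powers of the trigonometric polynomial
  \<open>\<Prod>\<^sub>j (1 + cos (2 \<pi> (x\<^sub>j - a\<^sub>j))) / 2\<close>, which concentrate at the point \<open>a\<close>.
\<close>

section \<open>Integration over the unit cube\<close>

text \<open>With the cube as the whole space this is a probability measure: continuous functions are
  bounded there, hence integrable, and constant bounds pass through the integral.\<close>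

definition cube_measure :: "nat \<Rightarrow> (nat \<Rightarrow> real) measure" where
  "cube_measure d = restrict_space (lebesgue_vecs d) (unit_cube d)"

lemma sets_unit_cube: "unit_cube d \<in> sets (lebesgue_vecs d)"
  unfolding unit_cube_def lebesgue_vecs_def by (intro sets_PiM_I_finite) auto

lemma space_lebesgue_vecs: "space (lebesgue_vecs d) = real_vecs d"
  by (simp add: lebesgue_vecs_def real_vecs_def space_PiM)

lemma unit_cube_subset_real_vecs: "unit_cube d \<subseteq> real_vecs d"
  unfolding unit_cube_def real_vecs_def by (auto simp: PiE_iff)

lemma space_cube_measure [simp]: "space (cube_measure d) = unit_cube d"
  using unit_cube_subset_real_vecs[of d]
  by (auto simp: cube_measure_def space_restrict_space space_lebesgue_vecs)

lemma cube_integral_eq: "cube_integral d f = integral\<^sup>L (cube_measure d) f"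
  using sets_unit_cube[of d]
  by (simp add: cube_integral_def set_lebesgue_integral_def cube_measure_def integral_restrict_space)

lemma product_sigma_finite_lborel: "product_sigma_finite (\<lambda>_::nat. lborel :: real measure)"
  by (simp add: product_sigma_finite_def sigma_finite_lborel)

lemma emeasure_lebesgue_vecs_PiE:
  assumes "\<And>j. j \<in> {1..d} \<Longrightarrow> A j \<in> sets borel"
  shows "emeasure (lebesgue_vecs d) (PiE {1..d} A) = (\<Prod>j\<in>{1..d}. emeasure lborel (A j))"
  unfolding lebesgue_vecs_def
  by (rule product_sigma_finite.emeasure_PiM[OF product_sigma_finite_lborel]) (use assms in auto)

lemma prob_space_cube_measure: "prob_space (cube_measure d)"
proof
  have "emeasure (cube_measure d) (unit_cube d) = emeasure (lebesgue_vecs d) (unit_cube d)"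
    using sets_unit_cube by (simp add: cube_measure_def emeasure_restrict_space)
  also have "\<dots> = 1"
    unfolding unit_cube_def by (subst emeasure_lebesgue_vecs_PiE) auto
  finally show "emeasure (cube_measure d) (space (cube_measure d)) = 1" by simp
qed

text \<open>The cube sits in the space of all functions on \<open>nat\<close>, so Tychonoff is
  applied to a product over every index, with the compact factor \<open>{undefined}\<close> outside
  \<open>{1..d}\<close>.\<close>

lemma compact_unit_cube: "compact (unit_cube d)"
proof -
  have "unit_cube d = PiE UNIV (\<lambda>j. if j \<in> {1..d} then {0..1} else {undefined})"
    unfolding unit_cube_def by (fastforce simp: PiE_iff extensional_def split: if_splits)
  moreover have "compactin (product_topology (\<lambda>_::nat. euclidean :: real topology) UNIV)
                  (PiE UNIV (\<lambda>j. if j \<in> {1..d} then {0..1} else {undefined}))"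
    by (subst compactin_PiE) auto
  ultimately show ?thesis
    by (simp add: euclidean_product_topology)
qed

text \<open>Links the product sigma-algebra on \<open>{1..d}\<close> with the Borel sets of the full
  function space: the coordinates outside \<open>{1..d}\<close> are constantly
  \<open>undefined\<close>, hence measurable. Continuity then yields measurability.\<close>

lemma measurable_cube_measure_ident:
  "(\<lambda>x. x) \<in> measurable (cube_measure d) (restrict_space borel (unit_cube d))"
proof (rule measurable_restrict_space2)
  show "(\<lambda>x. x) \<in> borel_measurable (cube_measure d)"
  proof (rule measurable_coordinatewise_then_product)
    fix i
    have "(\<lambda>x. x i) \<in> borel_measurable (lebesgue_vecs d)"
    proof (cases "i \<in> {1..d}")
      case True
      then show ?thesis unfolding lebesgue_vecs_def
        by (metis measurable_component_singleton measurable_lborel1)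
    next
      case False
      then show ?thesis
        by (subst measurable_cong[where g = "\<lambda>_. undefined"])
           (auto simp: space_lebesgue_vecs real_vecs_def PiE_iff extensional_def)
    qed
    then show "(\<lambda>x. x i) \<in> borel_measurable (cube_measure d)"
      unfolding cube_measure_def by (rule measurable_restrict_space1)
  qed
qed auto

lemma borel_measurable_cube_measure:
  fixes f :: "(nat \<Rightarrow> real) \<Rightarrow> 'a :: topological_space"
  assumes "continuous_on (unit_cube d) f"
  shows "f \<in> borel_measurable (cube_measure d)"
  using measurable_compose[OF measurable_cube_measure_ident borel_measurable_continuous_on_restrict[OF assms]] by simp

lemma integrable_cube_measure:
  fixes f :: "(nat \<Rightarrow> real) \<Rightarrow> 'a :: {banach, second_countable_topology}"
  assumes "continuous_on (unit_cube d) f"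
  shows "integrable (cube_measure d) f"
proof -
  interpret prob_space "cube_measure d" by (rule prob_space_cube_measure)
  have "bounded (f ` unit_cube d)"
    by (intro compact_imp_bounded compact_continuous_image assms compact_unit_cube)
  then obtain B where "\<And>x. x \<in> unit_cube d \<Longrightarrow> norm (f x) \<le> B"
    by (auto simp: bounded_iff)
  then show ?thesis
    by (intro integrable_const_bound[where B = B] borel_measurable_cube_measure assms) (auto intro!: AE_I2)
qed

section \<open>Harmonics and their integrals\<close>

definition harmonic :: "nat \<Rightarrow> (nat \<Rightarrow> int) \<Rightarrow> (nat \<Rightarrow> real) \<Rightarrow> complex" where
  "harmonic d h x = exp (2 * of_real pi * \<i> * of_real (\<Sum>j=1..d. real_of_int (h j) * x j))"

lemma norm_harmonic [simp]: "cmod (harmonic d h x) = 1"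
  unfolding harmonic_def by (simp add: norm_exp_eq_Re)

lemma harmonic_add: "harmonic d (\<lambda>j. h j + k j) x = harmonic d h x * harmonic d k x"
  unfolding harmonic_def by (simp add: exp_add[symmetric] distrib_left distrib_right sum.distrib)

lemma harmonic_cong: "(\<And>j. j \<in> {1..d} \<Longrightarrow> h j = k j) \<Longrightarrow> harmonic d h x = harmonic d k x"
  unfolding harmonic_def by (intro arg_cong[where f = exp]) (auto intro!: sum.cong)

lemma harmonic_0: "(\<And>j. j \<in> {1..d} \<Longrightarrow> h j = 0) \<Longrightarrow> harmonic d h x = 1"
  unfolding harmonic_def by simp

lemma continuous_on_harmonic [continuous_intros]: "continuous_on A (harmonic d h)"
proof -
  have "continuous_on UNIV (harmonic d h)"
    unfolding harmonic_def by (intro continuous_intros continuous_on_product_coordinates)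
  then show ?thesis by (rule continuous_on_subset) simp
qed

lemma fourier_coeff_eq:
  "fourier_coeff d f h = integral\<^sup>L (cube_measure d) (\<lambda>x. f x * harmonic d (\<lambda>j. - h j) x)"
  unfolding fourier_coeff_def cube_integral_eq harmonic_def by (simp add: sum_negf)

text \<open>For nonzero \<open>m\<close> the antiderivative \<open>exp (c * t) / c\<close> takes
  equal values at 0 and 1, because \<open>exp c = 1\<close>.\<close>

lemma integral_exp_int:
  "(\<integral>t. indicator {0..1} t *\<^sub>R exp (2 * of_real pi * \<i> * of_real (real_of_int m * t)) \<partial>lborel)
     = (if m = 0 then 1 else 0)"
proof (cases "m = 0")
  case False
  define c :: complex where "c = 2 * of_real pi * \<i> * of_int m"
  have c: "c \<noteq> 0" using False by (simp add: c_def)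
  have "(\<integral>t. indicator {0..1} t *\<^sub>R exp (c * of_real t) \<partial>lborel) = exp (c * of_real 1) / c - exp (c * of_real 0) / c"
  proof (rule integral_FTC_atLeastAtMost)
    fix t :: real
    show "((\<lambda>t. exp (c * of_real t) / c) has_vector_derivative exp (c * of_real t)) (at t within {0..1})"
      by (rule has_vector_derivative_real_field) (use c in \<open>auto intro!: derivative_eq_intros\<close>)
  qed (auto intro!: continuous_intros)
  moreover have "exp c = 1"
    unfolding c_def exp_eq_1 by (auto intro!: exI[of _ m])
  ultimately show ?thesis using False by (simp add: c_def mult.assoc)
qed simp

text \<open>Both the harmonic and the indicator of the cube are products over the coordinates, so
  Fubini reduces the integral to \<open>integral_exp_int\<close>. An extensional point outside the
  cube leaves \<open>{0..1}\<close> in some coordinate, which makes the product vanish.\<close>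

lemma integral_harmonic:
  "integral\<^sup>L (cube_measure d) (harmonic d h) = of_bool (\<forall>j\<in>{1..d}. h j = 0)"
proof -
  interpret product_sigma_finite "\<lambda>_::nat. lborel :: real measure"
    by (rule product_sigma_finite_lborel)
  let ?e = "\<lambda>j t. exp (2 * of_real pi * \<i> * of_real (real_of_int (h j) * t)) :: complex"
  have "integral\<^sup>L (cube_measure d) (harmonic d h)
      = (\<integral>x. indicator (unit_cube d) x *\<^sub>R harmonic d h x \<partial>lebesgue_vecs d)"
    unfolding cube_measure_def using sets_unit_cube by (subst integral_restrict_space) auto
  also have "\<dots> = (\<integral>x. (\<Prod>j\<in>{1..d}. indicator {0..1} (x j) *\<^sub>R ?e j (x j)) \<partial>PiM {1..d} (\<lambda>_. lborel))"
    unfolding lebesgue_vecs_def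
  proof (intro Bochner_Integration.integral_cong refl)
    fix x :: "nat \<Rightarrow> real" assume "x \<in> space (PiM {1..d} (\<lambda>_. lborel))"
    then have x: "x \<in> extensional {1..d}" by (auto simp: space_PiM PiE_iff)
    have e: "harmonic d h x = (\<Prod>j\<in>{1..d}. ?e j (x j))"
      unfolding harmonic_def by (subst exp_sum[symmetric]) (auto simp: sum_distrib_left)
    show "indicator (unit_cube d) x *\<^sub>R harmonic d h x = (\<Prod>j\<in>{1..d}. indicator {0..1} (x j) *\<^sub>R ?e j (x j))"
    proof (cases "x \<in> unit_cube d")
      case True
      then have "\<And>j. j \<in> {1..d} \<Longrightarrow> x j \<in> {0..1}" unfolding unit_cube_def by (meson PiE_mem)
      then show ?thesis using True unfolding e by (auto intro!: prod.cong)
    next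
      case False
      then obtain j where "j \<in> {1..d}" "x j \<notin> {0..1}" using x by (auto simp: unit_cube_def PiE_iff)
      then have "(\<Prod>j\<in>{1..d}. indicator {0..1} (x j) *\<^sub>R ?e j (x j)) = 0"
        by (intro prod_zero) (auto intro!: bexI[of _ j])
      then show ?thesis using False by simp
    qed
  qed
  also have "\<dots> = (\<Prod>j\<in>{1..d}. (\<integral>t. indicator {0..1} t *\<^sub>R ?e j t \<partial>lborel))"
    by (rule product_integral_prod) (auto intro!: borel_integrable_compact continuous_intros)
  also have "\<dots> = of_bool (\<forall>j\<in>{1..d}. h j = 0)"
    unfolding integral_exp_int by (auto intro!: prod_zero)
  finally show ?thesis .
qed

section \<open>Continuous functions with vanishing Fourier coefficients\<close>

definition vanishing_spectrum :: "nat \<Rightarrow> ((nat \<Rightarrow> real) \<Rightarrow> complex) \<Rightarrow> bool" where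
  "vanishing_spectrum d g \<longleftrightarrow> continuous_on (unit_cube d) g \<and>
     (\<forall>h. integral\<^sup>L (cube_measure d) (\<lambda>x. g x * harmonic d h x) = 0)"

text \<open>A harmonic factor shifts the frequency, and the integrals vanish at every frequency.
  Together with closure under sums, this gives stability under multiplication by trigonometric
  polynomials.\<close>

lemma vanishing_spectrum_times_harmonic:
  assumes "vanishing_spectrum d g"
  shows "vanishing_spectrum d (\<lambda>x. g x * (c * harmonic d k x))"
proof -
  have "integral\<^sup>L (cube_measure d) (\<lambda>x. g x * (c * harmonic d k x) * harmonic d h x) = 0" for h
  proof -
    have "(\<lambda>x. g x * (c * harmonic d k x) * harmonic d h x) = (\<lambda>x. c * (g x * harmonic d (\<lambda>j. k j + h j) x))"
      by (simp add: harmonic_add fun_eq_iff)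
    then show ?thesis using assms by (simp add: vanishing_spectrum_def)
  qed
  then show ?thesis using assms
    unfolding vanishing_spectrum_def by (auto intro!: continuous_intros)
qed

lemma vanishing_spectrum_add:
  assumes "vanishing_spectrum d f" "vanishing_spectrum d g"
  shows "vanishing_spectrum d (\<lambda>x. f x + g x)"
proof -
  have "integral\<^sup>L (cube_measure d) (\<lambda>x. f x * harmonic d h x + g x * harmonic d h x) = 0" for h
    using assms unfolding vanishing_spectrum_def
    by (subst Bochner_Integration.integral_add) (auto intro!: integrable_cube_measure continuous_intros)
  then show ?thesis using assms
    unfolding vanishing_spectrum_def by (auto intro!: continuous_intros simp: distrib_right)
qed

section \<open>A trigonometric kernel that peaks at one interior point\<close>

text \<open>This is the square of \<open>cos (pi * (t - a))\<close>, written as a trigonometric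
  polynomial of degree 1.\<close>

definition cos_factor :: "real \<Rightarrow> real \<Rightarrow> real" where
  "cos_factor a t = (1 + cos (2 * pi * (t - a))) / 2"

lemma cos_factor_nonneg: "0 \<le> cos_factor a t"
proof -
  have "0 \<le> (1 + c) / 2" if "-1 \<le> c" for c :: real using that by simp
  then show ?thesis unfolding cos_factor_def using cos_ge_minus_one by blast
qed

lemma cos_factor_le_1: "cos_factor a t \<le> 1"
  unfolding cos_factor_def by simp

text \<open>The maximum recurs with period 1. The strict bounds on \<open>a\<close> keep
  \<open>t - a\<close> strictly between -1 and 1; for \<open>a = 0\<close> the point
  \<open>t = 1\<close> would be a second maximum.\<close>

lemma cos_factor_eq_1:
  assumes "cos_factor a t = 1" "0 < a" "a < 1" "0 \<le> t" "t \<le> 1"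
  shows "t = a"
proof -
  have "cos (2 * pi * (t - a)) = 1" using assms(1) by (simp add: cos_factor_def)
  then obtain m :: int where "2 * pi * (t - a) = real_of_int m * 2 * pi"
    unfolding cos_one_2pi_int by blast
  then have m: "t - a = real_of_int m" by simp
  then have "real_of_int m < 1" "real_of_int m > -1" using assms by linarith+
  then have "m = 0" by linarith
  then show ?thesis using m by simp
qed

text \<open>Euler's formula: only the frequency 0 and plus or minus the \<open>j\<close>-th unit
  vector occur, and the shift by \<open>a\<close> becomes a constant phase in the
  coefficients.\<close>

lemma cos_factor_harmonic:
  assumes "j \<in> {1..d}"
  shows "complex_of_real (cos_factor a (x j)) = 1 / 2 * harmonic d (\<lambda>_. 0) x
     + exp (- (2 * of_real pi * \<i> * of_real a)) / 4 * harmonic d (\<lambda>i. of_bool (i = j)) x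
     + exp (2 * of_real pi * \<i> * of_real a) / 4 * harmonic d (\<lambda>i. - of_bool (i = j)) x"
proof -
  have s: "(\<Sum>i=1..d. real_of_int (of_bool (i = j)) * x i) = x j"
  proof -
    have "(\<Sum>i=1..d. real_of_int (of_bool (i = j)) * x i) = (\<Sum>i\<in>{1..d}. if i = j then x i else 0)"
      by (intro sum.cong) auto
    then show ?thesis using assms by simp
  qed
  have s': "(\<Sum>i=1..d. real_of_int (- of_bool (i = j)) * x i) = - x j"
    using s by (simp add: sum_negf)
  have e: "harmonic d (\<lambda>i. of_bool (i = j)) x = exp (2 * of_real pi * \<i> * of_real (x j))"
    "harmonic d (\<lambda>i. - of_bool (i = j)) x = exp (- (2 * of_real pi * \<i> * of_real (x j)))"
    unfolding harmonic_def s s' by simp_all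
  have "complex_of_real (cos_factor a (x j)) = (1 + cos (of_real (2 * pi * (x j - a)))) / 2"
    unfolding cos_factor_def cos_of_real by simp
  moreover have "exp (\<i> * complex_of_real (2 * pi * (x j - a))) =
      exp (2 * of_real pi * \<i> * of_real (x j)) * exp (- (2 * of_real pi * \<i> * of_real a))"
    unfolding exp_add[symmetric] by (rule arg_cong[where f = exp]) (simp add: algebra_simps)
  moreover have "exp (- (\<i> * complex_of_real (2 * pi * (x j - a)))) =
      exp (- (2 * of_real pi * \<i> * of_real (x j))) * exp (2 * of_real pi * \<i> * of_real a)"
    unfolding exp_add[symmetric] by (rule arg_cong[where f = exp]) (simp add: algebra_simps)
  ultimately show ?thesis
    unfolding e cos_exp_eq harmonic_0[of d "\<lambda>_. 0" x, OF refl] by (simp add: add_divide_distrib mult.commute)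
qed

lemma vanishing_spectrum_times_cos_factor:
  assumes "vanishing_spectrum d g" "j \<in> {1..d}"
  shows "vanishing_spectrum d (\<lambda>x. g x * complex_of_real (cos_factor a (x j)))"
proof -
  have "vanishing_spectrum d (\<lambda>x. g x * (1 / 2 * harmonic d (\<lambda>_. 0) x)
     + g x * (exp (- (2 * of_real pi * \<i> * of_real a)) / 4 * harmonic d (\<lambda>i. of_bool (i = j)) x)
     + g x * (exp (2 * of_real pi * \<i> * of_real a) / 4 * harmonic d (\<lambda>i. - of_bool (i = j)) x))"
    by (rule vanishing_spectrum_add vanishing_spectrum_times_harmonic assms(1))+
  then show ?thesis
    by (simp only: cos_factor_harmonic[OF assms(2)] distrib_left)
qed

definition peak_kernel :: "nat \<Rightarrow> (nat \<Rightarrow> real) \<Rightarrow> (nat \<Rightarrow> real) \<Rightarrow> real" where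
  "peak_kernel d a x = (\<Prod>j\<in>{1..d}. cos_factor (a j) (x j))"

lemma vanishing_spectrum_times_peak_kernel:
  assumes "vanishing_spectrum d g"
  shows "vanishing_spectrum d (\<lambda>x. g x * complex_of_real (peak_kernel d a x))"
proof -
  have "vanishing_spectrum d (\<lambda>x. g x * complex_of_real (\<Prod>j\<in>J. cos_factor (a j) (x j)))"
    if "finite J" "J \<subseteq> {1..d}" for J
    using that
  proof (induction J)
    case empty
    then show ?case using assms by simp
  next
    case (insert j J)
    then have "vanishing_spectrum d (\<lambda>x. (g x * complex_of_real (\<Prod>j\<in>J. cos_factor (a j) (x j)))
        * complex_of_real (cos_factor (a j) (x j)))"
      by (intro vanishing_spectrum_times_cos_factor) auto
    then show ?case using insert by (simp add: mult_ac)
  qed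
  then show ?thesis unfolding peak_kernel_def by simp
qed

lemma vanishing_spectrum_times_peak_kernel_power:
  assumes "vanishing_spectrum d g"
  shows "vanishing_spectrum d (\<lambda>x. g x * complex_of_real (peak_kernel d a x ^ k))"
proof (induction k)
  case (Suc k)
  from vanishing_spectrum_times_peak_kernel[OF this, of a] show ?case by (simp add: mult_ac)
qed (use assms in simp)

lemma peak_kernel_nonneg: "0 \<le> peak_kernel d a x"
  unfolding peak_kernel_def by (intro prod_nonneg) (simp add: cos_factor_nonneg)

lemma peak_kernel_self: "peak_kernel d a a = 1"
  unfolding peak_kernel_def cos_factor_def by simp

lemma continuous_on_peak_kernel: "continuous_on A (peak_kernel d a)"
proof -
  have "continuous_on UNIV (peak_kernel d a)"
    unfolding peak_kernel_def cos_factor_def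
    by (intro continuous_intros continuous_on_product_coordinates) auto
  then show ?thesis by (rule continuous_on_subset) simp
qed

text \<open>A point other than \<open>a\<close> differs from it in some coordinate of
  \<open>{1..d}\<close>, both being extensional. That factor is below 1 and the others are at most
  1.\<close>

lemma peak_kernel_less_1:
  assumes "a \<in> ({1..d} \<rightarrow>\<^sub>E {0<..<1})" "x \<in> unit_cube d" "x \<noteq> a"
  shows "peak_kernel d a x < 1"
proof -
  have "\<exists>j\<in>{1..d}. x j \<noteq> a j"
  proof (rule ccontr)
    assume "\<not> ?thesis"
    then have "x j = a j" for j
      using assms(1,2) by (cases "j \<in> {1..d}") (auto simp: unit_cube_def PiE_iff extensional_def)
    then show False using assms(3) by blast
  qed
  then obtain j where j: "j \<in> {1..d}" "x j \<noteq> a j" by blast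
  have "x j \<in> {0..1}" "a j \<in> {0<..<1}" using assms j unfolding unit_cube_def by (auto simp: PiE_iff)
  then have "cos_factor (a j) (x j) \<noteq> 1" using cos_factor_eq_1[of "a j" "x j"] j by auto
  then have less: "cos_factor (a j) (x j) < 1" using cos_factor_le_1[of "a j" "x j"] by simp
  have "peak_kernel d a x = cos_factor (a j) (x j) * (\<Prod>j\<in>{1..d} - {j}. cos_factor (a j) (x j))"
    unfolding peak_kernel_def using j by (simp add: prod.remove)
  also have "\<dots> \<le> cos_factor (a j) (x j) * 1"
    by (intro mult_left_mono prod_le_1) (auto simp: cos_factor_nonneg cos_factor_le_1)
  finally show ?thesis using less by simp
qed

lemma open_cube_subset: "({1..d} \<rightarrow>\<^sub>E {0<..<1}) \<subseteq> unit_cube d"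
  unfolding unit_cube_def by (intro PiE_mono) auto

lemma emeasure_lborel_open_pos:
  fixes U :: "real set"
  assumes "open U" "y \<in> U"
  shows "emeasure lborel U > 0"
proof -
  obtain e where e: "e > 0" "ball y e \<subseteq> U" using assms openE by blast
  have "0 < emeasure lborel {y - e<..<y + e}" using e by simp
  also have "\<dots> \<le> emeasure lborel U"
    using e assms by (intro emeasure_mono) (auto simp: ball_eq_greaterThanLessThan)
  finally show ?thesis .
qed

text \<open>A basic open box around \<open>a\<close> inside \<open>U\<close>, cut down to the open
  cube, has as its volume a product of positive lengths.\<close>

lemma measure_cube_measure_open_pos:
  assumes "open U" "a \<in> U" "a \<in> ({1..d} \<rightarrow>\<^sub>E {0<..<1})"
  shows "measure (cube_measure d) (U \<inter> unit_cube d) > 0"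
proof -
  interpret prob_space "cube_measure d" by (rule prob_space_cube_measure)
  have "openin (product_topology (\<lambda>_. euclidean) UNIV) U"
    using assms(1) by (simp add: euclidean_product_topology)
  from product_topology_open_contains_basis[OF this assms(2)]
  obtain X where X: "a \<in> PiE UNIV X" "\<And>i. open (X i)" "PiE UNIV X \<subseteq> U" by auto
  define B where "B = PiE {1..d} (\<lambda>j. X j \<inter> {0<..<1})"
  have B_cube: "B \<subseteq> unit_cube d"
    unfolding B_def unit_cube_def by (intro PiE_mono) auto
  have B_U: "B \<subseteq> U"
  proof
    fix x assume x: "x \<in> B"
    have "x i \<in> X i" for i
    proof (cases "i \<in> {1..d}")
      case True then show ?thesis using x unfolding B_def by (auto simp: PiE_iff)
    next
      case False
      \<comment> \<open>Outside \<open>{1..d}\<close> both points have the value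
        \<open>undefined\<close>, so the constraint \<open>X i\<close> is inherited from
        \<open>a\<close>.\<close>
      then have "x i = a i" using x assms(3) unfolding B_def by (metis PiE_arb)
      then show ?thesis using X(1) by (auto simp: PiE_iff)
    qed
    then show "x \<in> U" using X(3) by (auto simp: PiE_iff)
  qed
  have meas: "B \<in> sets (lebesgue_vecs d)"
    unfolding B_def lebesgue_vecs_def by (intro sets_PiM_I_finite) (auto intro!: borel_open open_Int X)
  have "0 < (\<Prod>j\<in>{1..d}. emeasure lborel (X j \<inter> {0<..<1}))"
  proof -
    have "0 < emeasure lborel (X j \<inter> {0<..<1})" if "j \<in> {1..d}" for j
    proof (rule emeasure_lborel_open_pos)
      show "open (X j \<inter> {0<..<1})" by (intro open_Int X open_greaterThanLessThan)
      show "a j \<in> X j \<inter> {0<..<1}" using X(1) assms(3) that by (metis IntI PiE_mem UNIV_I)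
    qed
    then show ?thesis by (simp add: zero_less_iff_neq_zero)
  qed
  also have "\<dots> = emeasure (lebesgue_vecs d) B"
    unfolding B_def by (subst emeasure_lebesgue_vecs_PiE) (auto intro!: borel_open open_Int X)
  also have "\<dots> = emeasure (cube_measure d) B"
    unfolding cube_measure_def using sets_unit_cube B_cube by (simp add: emeasure_restrict_space)
  also have "\<dots> \<le> emeasure (cube_measure d) (U \<inter> unit_cube d)"
  proof (rule emeasure_mono)
    have "(\<lambda>x. x) -` (U \<inter> unit_cube d) \<inter> space (cube_measure d) \<in> sets (cube_measure d)"
      by (rule measurable_sets[OF measurable_cube_measure_ident])
         (use assms(1) in \<open>auto simp: sets_restrict_space intro!: image_eqI[of _ _ U]\<close>)
    then show "U \<inter> unit_cube d \<in> sets (cube_measure d)" by simp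
  qed (use B_U B_cube in auto)
  finally show ?thesis by (simp add: emeasure_eq_measure)
qed

text \<open>If \<open>g a\<close> were nonzero, the integrals of \<open>g\<close> against powers of
  the kernel would be dominated by a neighbourhood of \<open>a\<close>: its contribution is at least
  of order \<open>s ^ k\<close>, while the part away from \<open>a\<close> is at most of order
  \<open>t ^ k\<close> with \<open>t < s\<close>. Yet all these integrals are 0.\<close>

lemma vanishing_spectrum_interior:
  assumes g: "vanishing_spectrum d g" and a: "a \<in> ({1..d} \<rightarrow>\<^sub>E {0<..<1})"
  shows "g a = 0"
proof (rule ccontr)
  assume ga: "g a \<noteq> 0"
  interpret prob_space "cube_measure d" by (rule prob_space_cube_measure)
  have cont_g: "continuous_on (unit_cube d) g" using g by (simp add: vanishing_spectrum_def)
  have a_cube: "a \<in> unit_cube d" using a open_cube_subset by blast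
  let ?T = "peak_kernel d a"
  \<comment> \<open>Multiplying by \<open>cnj (g a)\<close> rotates the value at \<open>a\<close> to
    a positive real, so the real part is positive near \<open>a\<close>.\<close>
  define \<phi> where "\<phi> x = Re (cnj (g a) * g x)" for x
  have cont_\<phi>: "continuous_on (unit_cube d) \<phi>" unfolding \<phi>_def by (intro continuous_intros cont_g)
  have \<phi>a: "\<phi> a = (cmod (g a))\<^sup>2"
    unfolding \<phi>_def cmod_power2 by (simp add: power2_eq_square)
  define c where "c = \<phi> a / 2"
  have c: "c > 0" "c < \<phi> a" using ga by (auto simp: c_def \<phi>a)
  obtain U where U: "open U" "U \<inter> unit_cube d = \<phi> -` {c<..} \<inter> unit_cube d"
    using cont_\<phi> unfolding continuous_on_open_invariant by (metis open_greaterThan)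
  have aU: "a \<in> U" using U(2) c a_cube by auto
  have "compact (unit_cube d - U)" using compact_unit_cube U(1) by (intro compact_diff)
  have "\<exists>t. 0 \<le> t \<and> t < 1 \<and> (\<forall>x\<in>unit_cube d - U. ?T x \<le> t)"
  proof (cases "unit_cube d - U = {}")
    case False
    obtain y where y: "y \<in> unit_cube d - U" "\<And>x. x \<in> unit_cube d - U \<Longrightarrow> ?T x \<le> ?T y"
      using continuous_attains_sup[OF \<open>compact (unit_cube d - U)\<close> False continuous_on_peak_kernel[of _ d a]] by blast
    then have "?T y < 1" using aU by (intro peak_kernel_less_1 a) auto
    then show ?thesis using y peak_kernel_nonneg by blast
  qed (auto intro!: exI[of _ 0])
  then obtain t where t: "0 \<le> t" "t < 1" "\<And>x. x \<in> unit_cube d \<Longrightarrow> x \<notin> U \<Longrightarrow> ?T x \<le> t" by blast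
  \<comment> \<open>The midpoint of \<open>t\<close> and 1: the kernel exceeds \<open>s\<close> near
    \<open>a\<close>, and \<open>s\<close> beats the bound \<open>t\<close> valid off
    \<open>U\<close>.\<close>
  define s where "s = (1 + t) / 2"
  have s: "t < s" "s < 1" "0 < s" using t by (auto simp: s_def)
  define V where "V = U \<inter> ?T -` {s<..}"
  have "open V" unfolding V_def
    by (intro open_Int U(1) open_vimage open_greaterThan continuous_on_peak_kernel)
  moreover have "a \<in> V" unfolding V_def using aU s by (simp add: peak_kernel_self)
  ultimately have vol: "measure (cube_measure d) (V \<inter> unit_cube d) > 0"
    using a by (rule measure_cube_measure_open_pos)
  \<comment> \<open>A set outside the sigma-algebra has measure 0 by convention, so the positive
    measure already implies measurability.\<close>
  have V_meas: "V \<inter> unit_cube d \<in> sets (cube_measure d)"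
  proof (rule ccontr)
    assume "V \<inter> unit_cube d \<notin> sets (cube_measure d)"
    then show False using vol by (simp add: measure_notin_sets)
  qed
  define v where "v = measure (cube_measure d) (V \<inter> unit_cube d)"
  define C where "C = integral\<^sup>L (cube_measure d) (\<lambda>x. \<bar>\<phi> x\<bar>)"
  have bound: "c * s ^ k * v \<le> C * t ^ k" for k
  proof -
    have "integral\<^sup>L (cube_measure d) (\<lambda>x. g x * complex_of_real (?T x ^ k) * harmonic d (\<lambda>_. 0) x) = 0"
      using vanishing_spectrum_times_peak_kernel_power[OF g, of a k]
      unfolding vanishing_spectrum_def by blast
    then have zero: "integral\<^sup>L (cube_measure d) (\<lambda>x. g x * complex_of_real (?T x ^ k)) = 0"
      by (simp add: harmonic_0)
    have int: "integrable (cube_measure d) (\<lambda>x. g x * complex_of_real (?T x ^ k))"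
      by (intro integrable_cube_measure continuous_intros cont_g continuous_on_peak_kernel)
    have "0 = Re (cnj (g a) * integral\<^sup>L (cube_measure d) (\<lambda>x. g x * complex_of_real (?T x ^ k)))"
      unfolding zero by simp
    also have "\<dots> = Re (integral\<^sup>L (cube_measure d) (\<lambda>x. cnj (g a) * (g x * complex_of_real (?T x ^ k))))"
      by simp
    also have "\<dots> = integral\<^sup>L (cube_measure d) (\<lambda>x. Re (cnj (g a) * (g x * complex_of_real (?T x ^ k))))"
      using int by (intro integral_Re[symmetric]) auto
    also have "\<dots> = integral\<^sup>L (cube_measure d) (\<lambda>x. \<phi> x * ?T x ^ k)"
      by (intro Bochner_Integration.integral_cong refl) (simp add: \<phi>_def algebra_simps)
    finally have zero': "integral\<^sup>L (cube_measure d) (\<lambda>x. \<phi> x * ?T x ^ k) = 0" by simp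
    have int1: "integrable (cube_measure d) (\<lambda>x. indicator (V \<inter> unit_cube d) x *\<^sub>R (c * s ^ k))"
      using V_meas by (auto intro!: integrable_real_mult_indicator simp: emeasure_eq_measure)
    have int2: "integrable (cube_measure d) (\<lambda>x. \<bar>\<phi> x\<bar> * t ^ k)"
      by (intro integrable_cube_measure continuous_intros cont_\<phi>)
    have int3: "integrable (cube_measure d) (\<lambda>x. \<phi> x * ?T x ^ k)"
      by (intro integrable_cube_measure continuous_intros cont_\<phi> continuous_on_peak_kernel)
    \<comment> \<open>The integrand on the right is a pointwise minorant of
      \<open>\<phi> x * ?T x ^ k\<close>: on \<open>V\<close> both factors are bounded below, on the
      rest of \<open>U\<close> the product is nonnegative, and off \<open>U\<close> the kernel is at
      most \<open>t\<close>.\<close>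
    have "c * s ^ k * v - C * t ^ k
        = integral\<^sup>L (cube_measure d) (\<lambda>x. indicator (V \<inter> unit_cube d) x *\<^sub>R (c * s ^ k) - \<bar>\<phi> x\<bar> * t ^ k)"
      using int1 int2 V_meas by (simp add: v_def C_def)
    also have "\<dots> \<le> integral\<^sup>L (cube_measure d) (\<lambda>x. \<phi> x * ?T x ^ k)"
    proof (intro integral_mono Bochner_Integration.integrable_diff int1 int2 int3)
      fix x assume "x \<in> space (cube_measure d)"
      then have x: "x \<in> unit_cube d" by simp
      have nn: "0 \<le> \<bar>\<phi> x\<bar> * t ^ k" using t by simp
      consider "x \<in> V" | "x \<in> U" "x \<notin> V" | "x \<notin> U" by blast
      then show "indicator (V \<inter> unit_cube d) x *\<^sub>R (c * s ^ k) - \<bar>\<phi> x\<bar> * t ^ k \<le> \<phi> x * ?T x ^ k"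
      proof cases
        case 1
        then have "c < \<phi> x" "s < ?T x" using U(2) x unfolding V_def by auto
        then have "c * s ^ k \<le> \<phi> x * ?T x ^ k" using c s by (intro mult_mono power_mono) auto
        then show ?thesis using 1 x nn by simp
      next
        case 2
        then have "c < \<phi> x" using U(2) x by auto
        then have "0 \<le> \<phi> x * ?T x ^ k" using c by (simp add: peak_kernel_nonneg)
        then show ?thesis using 2 nn by simp
      next
        case 3
        then have "\<bar>\<phi> x\<bar> * ?T x ^ k \<le> \<bar>\<phi> x\<bar> * t ^ k"
          using t(3)[OF x] by (intro mult_left_mono power_mono peak_kernel_nonneg) auto
        moreover have "- (\<bar>\<phi> x\<bar> * ?T x ^ k) \<le> \<phi> x * ?T x ^ k"
          unfolding minus_mult_left by (intro mult_right_mono) (auto simp: peak_kernel_nonneg)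
        ultimately show ?thesis using 3 by (simp add: V_def)
      qed
    qed
    finally show ?thesis using zero' by simp
  qed
  \<comment> \<open>Dividing the bound by \<open>s ^ k\<close> leaves the fixed positive number
    \<open>c * v\<close> below a null sequence.\<close>
  have "(\<lambda>k. C * (t / s) ^ k) \<longlonglongrightarrow> C * 0"
    by (intro tendsto_mult tendsto_const LIMSEQ_power_zero) (use s t in auto)
  moreover have "c * v \<le> C * (t / s) ^ k" for k
    using bound[of k] s by (simp add: power_divide field_simps)
  ultimately have "c * v \<le> C * 0" by (intro LIMSEQ_le_const) auto
  moreover have "c * v > 0" using c vol by (simp add: v_def)
  ultimately show False by simp
qed

text \<open>Boundary points are limits of interior ones: the segment \<open>p\<close> from
  \<open>a\<close> to the centre of the cube is interior for positive parameters, and continuity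
  carries the value 0 back to \<open>a\<close>.\<close>

lemma vanishing_spectrum_eq_0:
  assumes g: "vanishing_spectrum d g" and a: "a \<in> unit_cube d"
  shows "g a = 0"
proof -
  define p where "p t = (\<lambda>j\<in>{1..d}. a j + t * (1 / 2 - a j))" for t :: real
  have a01: "0 \<le> a j" "a j \<le> 1" if "j \<in> {1..d}" for j
    using a that unfolding unit_cube_def by (auto simp: PiE_iff)
  have conv: "a j + t * (1 / 2 - a j) = (1 - t) * a j + t * (1 / 2)" for t j by (simp add: algebra_simps)
  have p0: "p 0 = a" using a unfolding p_def unit_cube_def by (auto simp: fun_eq_iff PiE_iff extensional_def)
  have p_in: "p t \<in> ({1..d} \<rightarrow>\<^sub>E {0<..<1})" if "0 < t" "t \<le> 1" for t
  proof -
    have "0 < a j + t * (1 / 2 - a j) \<and> a j + t * (1 / 2 - a j) < 1" if j: "j \<in> {1..d}" for j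
    proof -
      have "0 \<le> (1 - t) * a j" "(1 - t) * a j \<le> (1 - t) * 1"
        using a01[OF j] \<open>t \<le> 1\<close> by (simp_all add: mult_left_mono del: mult_1_right)
      then show ?thesis unfolding conv using \<open>0 < t\<close> by auto
    qed
    then show ?thesis unfolding p_def by auto
  qed
  have p_cube: "p t \<in> unit_cube d" if "0 \<le> t" "t \<le> 1" for t
  proof (cases "t = 0")
    case False
    then show ?thesis using p_in[of t] that open_cube_subset[of d] by auto
  qed (use p0 a in simp)
  have "continuous_on {0..1} p"
    unfolding p_def
  proof (rule continuous_on_coordinatewise_then_product)
    fix i show "continuous_on {0..1} (\<lambda>t. (\<lambda>j\<in>{1..d}. a j + t * (1 / 2 - a j)) i)"
      by (cases "i \<in> {1..d}") (auto intro!: continuous_intros)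
  qed
  then have "continuous_on {0..1} (\<lambda>t. g (p t))"
    using g p_cube unfolding vanishing_spectrum_def
    by (intro continuous_on_compose2[of "unit_cube d" g "{0..1}" p]) auto
  then have "((\<lambda>t. g (p t)) \<longlongrightarrow> g (p 0)) (at 0 within {0..1})"
    by (auto simp: continuous_on_def)
  then have "((\<lambda>t. g (p t)) \<longlongrightarrow> g a) (at_right 0)"
    by (simp add: p0 at_within_Icc_at_right)
  moreover have "((\<lambda>t. g (p t)) \<longlongrightarrow> 0) (at_right 0)"
    by (rule tendsto_eventually)
       (auto simp: eventually_at_right_field intro!: exI[of _ 1] vanishing_spectrum_interior[OF g p_in])
  ultimately show ?thesis
    using tendsto_unique trivial_limit_at_right_real by blast
qed

section \<open>Absolutely convergent Fourier series\<close>

lemma harmonic_mult_neg: "harmonic d k x * harmonic d (\<lambda>j. - h j) x = harmonic d (\<lambda>j. k j - h j) x"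
  by (simp add: harmonic_add[symmetric])

text \<open>Orthonormality of the harmonics. Membership in \<open>int_vecs d\<close> turns agreement
  on \<open>{1..d}\<close> into equality of functions.\<close>

lemma fourier_coeff_harmonic:
  assumes "k \<in> int_vecs d" "h \<in> int_vecs d"
  shows "fourier_coeff d (harmonic d k) h = of_bool (k = h)"
proof -
  have "(\<forall>j\<in>{1..d}. k j - h j = 0) \<longleftrightarrow> k = h"
    using assms unfolding int_vecs_def by (auto intro!: PiE_ext[of k "{1..d}" _ h])
  then show ?thesis
    unfolding fourier_coeff_eq harmonic_mult_neg
    by (subst integral_harmonic) (simp only:)
qed

definition fourier_series :: "nat \<Rightarrow> ((nat \<Rightarrow> int) \<Rightarrow> complex) \<Rightarrow> (nat \<Rightarrow> real) \<Rightarrow> complex" where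
  "fourier_series d c x = (\<Sum>\<^sub>\<infinity>h\<in>int_vecs d. c h * harmonic d h x)"

lemma fourier_series_has_sum:
  assumes "(\<lambda>h. cmod (c h)) summable_on int_vecs d"
  shows "((\<lambda>h. c h * harmonic d h x) has_sum fourier_series d c x) (int_vecs d)"
proof -
  have "(\<lambda>h. cmod (c h * harmonic d h x)) summable_on int_vecs d"
    using assms by (simp add: norm_mult)
  then show ?thesis unfolding fourier_series_def
    by (rule has_sum_infsum[OF abs_summable_summable])
qed

lemma uniform_limit_fourier_series:
  assumes "(\<lambda>h. cmod (c h)) summable_on int_vecs d"
  shows "uniform_limit UNIV (\<lambda>F x. \<Sum>h\<in>F. c h * harmonic d h x) (fourier_series d c)
           (finite_subsets_at_top (int_vecs d))"
  unfolding fourier_series_def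
  by (rule Weierstrass_m_test_general[OF _ assms]) (simp add: norm_mult)

lemma continuous_on_fourier_series:
  assumes "(\<lambda>h. cmod (c h)) summable_on int_vecs d"
  shows "continuous_on A (fourier_series d c)"
proof -
  have "continuous_on UNIV (fourier_series d c)"
    by (rule uniform_limit_theorem[OF _ uniform_limit_fourier_series[OF assms]])
       (auto intro!: always_eventually continuous_intros)
  then show ?thesis by (rule continuous_on_subset) simp
qed

lemma fourier_coeff_sum_harmonic:
  assumes "finite F" "F \<subseteq> int_vecs d" "h \<in> F"
  shows "fourier_coeff d (\<lambda>x. \<Sum>k\<in>F. c k * harmonic d k x) h = c h"
proof -
  have "fourier_coeff d (\<lambda>x. \<Sum>k\<in>F. c k * harmonic d k x) h
      = (\<Sum>k\<in>F. integral\<^sup>L (cube_measure d) (\<lambda>x. c k * (harmonic d k x * harmonic d (\<lambda>j. - h j) x)))"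
    unfolding fourier_coeff_eq sum_distrib_right mult.assoc
    by (intro Bochner_Integration.integral_sum integrable_cube_measure continuous_intros)
  also have "\<dots> = (\<Sum>k\<in>F. c k * fourier_coeff d (harmonic d k) h)"
    unfolding fourier_coeff_eq by simp
  also have "\<dots> = (\<Sum>k\<in>F. if k = h then c k else 0)"
    using assms by (intro sum.cong refl) (subst fourier_coeff_harmonic, auto)
  finally show ?thesis using assms by simp
qed

text \<open>Serves to pass from uniform convergence of functions to convergence of their
  coefficients; the cube has measure 1 and harmonics have modulus 1.\<close>

lemma norm_fourier_coeff_diff_le:
  assumes "continuous_on (unit_cube d) f" "continuous_on (unit_cube d) g"
    and le: "\<And>x. x \<in> unit_cube d \<Longrightarrow> cmod (f x - g x) \<le> e"
  shows "cmod (fourier_coeff d f h - fourier_coeff d g h) \<le> e"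
proof -
  interpret prob_space "cube_measure d" by (rule prob_space_cube_measure)
  let ?e = "harmonic d (\<lambda>j. - h j)"
  have "fourier_coeff d f h - fourier_coeff d g h = integral\<^sup>L (cube_measure d) (\<lambda>x. (f x - g x) * ?e x)"
    unfolding fourier_coeff_eq left_diff_distrib
    by (intro Bochner_Integration.integral_diff[symmetric] integrable_cube_measure continuous_intros assms)
  also have "cmod \<dots> \<le> integral\<^sup>L (cube_measure d) (\<lambda>x. cmod ((f x - g x) * ?e x))"
    by (rule integral_norm_bound)
  also have "\<dots> \<le> e"
    using le by (intro integral_le_const integrable_cube_measure continuous_intros assms)
      (auto intro!: AE_I2 simp: norm_mult)
  finally show ?thesis .
qed

text \<open>Along the net of finite partial sums the coefficient tends to that of the series by
  uniform convergence, but it equals \<open>c h\<close> as soon as the finite set contains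
  \<open>h\<close>.\<close>

lemma fourier_coeff_fourier_series:
  assumes c: "(\<lambda>h. cmod (c h)) summable_on int_vecs d" and h: "h \<in> int_vecs d"
  shows "fourier_coeff d (fourier_series d c) h = c h"
proof (rule tendsto_unique)
  let ?S = "\<lambda>F x. \<Sum>k\<in>F. c k * harmonic d k x" and ?F = "finite_subsets_at_top (int_vecs d)"
  show "((\<lambda>F. fourier_coeff d (?S F) h) \<longlongrightarrow> fourier_coeff d (fourier_series d c) h) ?F"
  proof (rule tendstoI)
    fix e :: real assume e: "e > 0"
    have "\<forall>\<^sub>F F in ?F. \<forall>x\<in>UNIV. dist (?S F x) (fourier_series d c x) < e / 2"
      by (rule uniform_limitD[OF uniform_limit_fourier_series[OF c]]) (use e in simp)
    then show "\<forall>\<^sub>F F in ?F. dist (fourier_coeff d (?S F) h) (fourier_coeff d (fourier_series d c) h) < e"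
    proof eventually_elim
      case (elim F)
      have "cmod (fourier_coeff d (?S F) h - fourier_coeff d (fourier_series d c) h) \<le> e / 2"
        using elim by (intro norm_fourier_coeff_diff_le continuous_intros continuous_on_fourier_series c)
          (auto simp: dist_norm intro: less_imp_le)
      then show ?case using e by (simp add: dist_norm)
    qed
  qed
  have "\<forall>\<^sub>F F in ?F. fourier_coeff d (?S F) h = c h"
    unfolding eventually_finite_subsets_at_top
    using h by (intro exI[of _ "{h}"]) (auto intro!: fourier_coeff_sum_harmonic)
  then show "((\<lambda>F. fourier_coeff d (?S F) h) \<longlongrightarrow> c h) ?F"
    by (rule tendsto_eventually)
qed auto

text \<open>The function and its Fourier series are continuous with the same coefficients, so their
  difference has vanishing spectrum.\<close>

lemma fourier_inversion:
  assumes f: "continuous_on (unit_cube d) f"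
    and c: "(\<lambda>h. cmod (fourier_coeff d f h)) summable_on int_vecs d"
    and x: "x \<in> unit_cube d"
  shows "f x = fourier_series d (fourier_coeff d f) x"
proof -
  let ?s = "fourier_series d (fourier_coeff d f)"
  have s: "continuous_on (unit_cube d) ?s" by (rule continuous_on_fourier_series[OF c])
  have "integral\<^sup>L (cube_measure d) (\<lambda>x. (f x - ?s x) * harmonic d h x) = 0" for h
  proof -
    \<comment> \<open>The sign is reversed because coefficients integrate against the conjugate
      harmonic, and the restriction puts the frequency into \<open>int_vecs d\<close>.\<close>
    define k where "k = (\<lambda>j\<in>{1..d}. - h j)"
    have k: "k \<in> int_vecs d" unfolding k_def int_vecs_def by auto
    have e: "harmonic d h x = harmonic d (\<lambda>j. - k j) x" for x
      by (rule harmonic_cong) (simp add: k_def)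
    have "integral\<^sup>L (cube_measure d) (\<lambda>x. (f x - ?s x) * harmonic d h x) = fourier_coeff d f k - fourier_coeff d ?s k"
      unfolding fourier_coeff_eq[of _ f k] fourier_coeff_eq[of _ ?s k] e left_diff_distrib
      by (intro Bochner_Integration.integral_diff integrable_cube_measure continuous_intros f s)
    then show ?thesis using fourier_coeff_fourier_series[OF c k] by simp
  qed
  then have "vanishing_spectrum d (\<lambda>x. f x - ?s x)"
    unfolding vanishing_spectrum_def by (auto intro!: continuous_intros f s)
  from vanishing_spectrum_eq_0[OF this x] show ?thesis by simp
qed

lemma harmonic_periodic:
  assumes "j \<in> {1..d}"
  shows "harmonic d h (x(j := x j + 1)) = harmonic d h x"
proof -
  have "(\<Sum>i=1..d. real_of_int (h i) * (x(j := x j + 1)) i)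
      = (\<Sum>i\<in>{1..d}. real_of_int (h i) * x i + (if i = j then real_of_int (h i) else 0))"
    by (intro sum.cong) (auto simp: algebra_simps)
  also have "\<dots> = (\<Sum>i=1..d. real_of_int (h i) * x i) + real_of_int (h j)"
    using assms by (simp add: sum.distrib)
  finally have "harmonic d h (x(j := x j + 1)) = harmonic d h x * exp (2 * of_real pi * \<i> * of_int (h j))"
    unfolding harmonic_def by (simp add: exp_add[symmetric] distrib_left)
  moreover have "exp (2 * of_real pi * \<i> * of_int (h j)) = 1"
    unfolding exp_eq_1 by (auto intro!: exI[of _ "h j"])
  ultimately show ?thesis by simp
qed

lemma one_periodic_fourier_series: "one_periodic d (fourier_series d c)"
  unfolding one_periodic_def fourier_series_def by (intro ballI infsum_cong) (simp only: harmonic_periodic)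

lemma square_integrable_cube_continuous:
  assumes "continuous_on (unit_cube d) f"
  shows "square_integrable_cube d f"
proof -
  have "f \<in> borel_measurable (cube_measure d)" by (rule borel_measurable_cube_measure[OF assms])
  moreover have "integrable (cube_measure d) (\<lambda>x. (cmod (f x))\<^sup>2)"
    by (intro integrable_cube_measure continuous_intros assms)
  moreover have "unit_cube d \<inter> space (lebesgue_vecs d) \<in> sets (lebesgue_vecs d)"
    by (intro sets.Int sets_unit_cube sets.top)
  ultimately show ?thesis
    unfolding square_integrable_cube_def cube_measure_def set_borel_measurable_def set_integrable_def
    using borel_measurable_restrict_space_iff[of "unit_cube d" "lebesgue_vecs d" f]
      integrable_restrict_space[of "unit_cube d" "lebesgue_vecs d" "\<lambda>x. (cmod (f x))\<^sup>2"]
    by blast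
qed

section \<open>Korobov weights and lattice rules\<close>

lemma korobov_r_pos:
  assumes "positive_weights \<gamma>"
  shows "korobov_r d \<alpha> \<gamma> h > 0"
proof -
  have "finite (supp d h)" unfolding supp_def by simp
  then have "\<gamma> (supp d h) > 0" using assms by (simp add: positive_weights_def)
  moreover have "(\<Prod>j\<in>supp d h. \<bar>real_of_int (h j)\<bar> powr \<alpha>) > 0"
    by (intro prod_pos) (auto simp: supp_def)
  ultimately show ?thesis unfolding korobov_r_def by simp
qed

text \<open>Nonnegative and negative integers each give a p-series, with 0 counted only in the first
  half. The value 1 at 0 is the factor of a coordinate outside the support.\<close>

lemma summable_on_int_powr:
  assumes "s < -1"
  shows "(\<lambda>k::int. if k = 0 then 1 else \<bar>real_of_int k\<bar> powr s) summable_on UNIV" (is "?f summable_on UNIV")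
proof -
  \<comment> \<open>Since \<open>0 powr s\<close> is 0 and not 1, the two sequences agree only from
    1 on.\<close>
  have "summable (\<lambda>n. ?f (int n))"
    using assms summable_real_powr_iff[of s]
    by (subst summable_cong[where g = "\<lambda>n. real n powr s"])
       (auto intro!: eventually_mono[OF eventually_gt_at_top[of 0]])
  then have nat: "(\<lambda>n. ?f (int n)) summable_on UNIV"
    by (subst summable_on_UNIV_nonneg_real_iff) auto
  then have "(\<lambda>n. ?f (int n)) summable_on (UNIV - {0})"
    by (rule summable_on_subset_banach) auto
  moreover have "(\<lambda>n. ?f (int n)) = ?f \<circ> (\<lambda>n. - int n)" by (auto simp: fun_eq_iff)
  ultimately have "?f summable_on ((\<lambda>n. - int n) ` (UNIV - {0}))"
    by (subst summable_on_reindex) (auto simp: inj_on_def)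
  moreover have "?f summable_on (int ` UNIV)"
    using nat by (subst summable_on_reindex) (auto simp: o_def)
  moreover have "int ` UNIV \<inter> (\<lambda>n. - int n) ` (UNIV - {0}) = {}" by auto
  ultimately have "?f summable_on (int ` UNIV \<union> (\<lambda>n. - int n) ` (UNIV - {0}))"
    by (intro summable_on_Un_disjoint)
  moreover have "int ` UNIV \<union> (\<lambda>n. - int n) ` (UNIV - {0}) = UNIV"
  proof (rule set_eqI)
    fix k :: int
    show "k \<in> int ` UNIV \<union> (\<lambda>n. - int n) ` (UNIV - {0}) \<longleftrightarrow> k \<in> UNIV"
    proof (cases "k \<ge> 0")
      case True
      then show ?thesis by (auto intro!: image_eqI[of _ int "nat k"])
    next
      case False
      then have "k = - int (nat (- k))" "nat (- k) \<noteq> 0" by auto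
      then have "k \<in> (\<lambda>n. - int n) ` (UNIV - {0})" by (intro image_eqI[of _ _ "nat (- k)"]) auto
      then show ?thesis by blast
    qed
  qed
  ultimately show ?thesis by simp
qed

text \<open>Only finitely many supports occur, so the sum \<open>C\<close> of all squared weights
  bounds each of them. What remains is a product of one-dimensional series with exponent
  \<open>-2 * \<alpha>\<close>, below -1.\<close>

lemma korobov_r_powi_summable:
  assumes \<alpha>: "\<alpha> > 1 / 2"
  shows "(\<lambda>h. korobov_r d \<alpha> \<gamma> h powi (-2)) summable_on int_vecs d"
proof (rule summable_on_comparison_test)
  let ?\<rho> = "\<lambda>k::int. if k = 0 then 1 else \<bar>real_of_int k\<bar> powr (-2 * \<alpha>)"
  define C where "C = (\<Sum>u\<in>Pow {1..d}. (\<gamma> u)\<^sup>2)"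
  have "Infinite_Set_Sum.abs_summable_on ?\<rho> UNIV"
    unfolding abs_summable_equivalent[symmetric] summable_on_iff_abs_summable_on_real[symmetric]
    by (rule summable_on_int_powr) (use \<alpha> in simp)
  then have "Infinite_Set_Sum.abs_summable_on (\<lambda>h. \<Prod>j\<in>{1..d}. ?\<rho> (h j)) (int_vecs d)"
    unfolding int_vecs_def by (intro abs_summable_on_prod_PiE) auto
  then have "(\<lambda>h. \<Prod>j\<in>{1..d}. ?\<rho> (h j)) summable_on int_vecs d"
    unfolding abs_summable_equivalent[symmetric] summable_on_iff_abs_summable_on_real[symmetric] .
  then show "(\<lambda>h. C * (\<Prod>j\<in>{1..d}. ?\<rho> (h j))) summable_on int_vecs d"
    by (rule summable_on_cmult_right)
next
  fix h
  let ?\<rho> = "\<lambda>k::int. if k = 0 then 1 else \<bar>real_of_int k\<bar> powr (-2 * \<alpha>)"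
  have "(\<Prod>j\<in>{1..d}. ?\<rho> (h j)) = (\<Prod>j\<in>supp d h. ?\<rho> (h j))"
    by (intro prod.mono_neutral_right) (auto simp: supp_def)
  also have "\<dots> = (\<Prod>j\<in>supp d h. inverse ((\<bar>real_of_int (h j)\<bar> powr \<alpha>)\<^sup>2))"
  proof (intro prod.cong refl)
    fix j assume "j \<in> supp d h"
    then have "h j \<noteq> 0" by (simp add: supp_def)
    then show "?\<rho> (h j) = inverse ((\<bar>real_of_int (h j)\<bar> powr \<alpha>)\<^sup>2)"
      by (simp add: powr_minus powr_power mult.commute)
  qed
  also have "\<dots> = inverse ((\<Prod>j\<in>supp d h. \<bar>real_of_int (h j)\<bar> powr \<alpha>)\<^sup>2)"
    by (simp only: prod_power_distrib prod_inversef[symmetric] o_def)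
  finally have eq: "korobov_r d \<alpha> \<gamma> h powi (-2) = (\<gamma> (supp d h))\<^sup>2 * (\<Prod>j\<in>{1..d}. ?\<rho> (h j))"
    unfolding korobov_r_def by (simp add: power_int_minus power_mult_distrib power_inverse)
  have "(\<gamma> (supp d h))\<^sup>2 \<le> (\<Sum>u\<in>Pow {1..d}. (\<gamma> u)\<^sup>2)"
    by (intro member_le_sum) (auto simp: supp_def)
  then show "korobov_r d \<alpha> \<gamma> h powi (-2) \<le> (\<Sum>u\<in>Pow {1..d}. (\<gamma> u)\<^sup>2) * (\<Prod>j\<in>{1..d}. ?\<rho> (h j))"
    unfolding eq by (intro mult_right_mono prod_nonneg) auto
  show "0 \<le> korobov_r d \<alpha> \<gamma> h powi (-2)"
    by (simp add: power_int_minus)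
qed

text \<open>The arithmetic-geometric mean inequality for \<open>?r * ?c\<close> and
  \<open>inverse ?r\<close> bounds each coefficient by terms of two convergent series: the squared
  norm and the inverse squares of \<open>korobov_r\<close>.\<close>

lemma korobov_space_coeff_summable:
  assumes \<alpha>: "\<alpha> > 1 / 2" and \<gamma>: "positive_weights \<gamma>" and f: "f \<in> korobov_space d \<alpha> \<gamma>"
  shows "(\<lambda>h. cmod (fourier_coeff d f h)) summable_on int_vecs d"
proof (rule summable_on_comparison_test)
  let ?r = "korobov_r d \<alpha> \<gamma>"
  show "(\<lambda>h. (?r h)\<^sup>2 * (cmod (fourier_coeff d f h))\<^sup>2 + ?r h powi (-2)) summable_on int_vecs d"
    using f by (intro summable_on_add korobov_r_powi_summable \<alpha>) (simp add: korobov_space_def)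
next
  fix h
  let ?r = "korobov_r d \<alpha> \<gamma> h" and ?c = "cmod (fourier_coeff d f h)"
  have r: "?r > 0" by (rule korobov_r_pos[OF \<gamma>])
  have "2 * (?r * ?c) * inverse ?r \<le> (?r * ?c)\<^sup>2 + (inverse ?r)\<^sup>2"
    by (rule sum_squares_bound)
  moreover have "2 * (?r * ?c) * inverse ?r = 2 * ?c" using r by simp
  moreover have "(?r * ?c)\<^sup>2 + (inverse ?r)\<^sup>2 = ?r\<^sup>2 * ?c\<^sup>2 + ?r powi (-2)"
    by (simp add: power_int_minus power_mult_distrib power_inverse)
  ultimately show "?c \<le> ?r\<^sup>2 * ?c\<^sup>2 + ?r powi (-2)"
    using norm_ge_zero[of "fourier_coeff d f h"] by linarith
qed simp

section \<open>Lattice rules as sums over the dual lattice\<close>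

lemma lattice_node_in_unit_cube:
  assumes "p > 0"
  shows "(\<lambda>j\<in>{1..d}. real_of_int ((int k * z j) mod int p) / real p) \<in> unit_cube d"
proof -
  have "real_of_int (a mod int p) / real p \<in> {0..1}" for a :: int
  proof -
    have "0 \<le> a mod int p" "a mod int p \<le> int p" using assms by (auto intro: less_imp_le)
    then have "0 \<le> real_of_int (a mod int p)" "real_of_int (a mod int p) \<le> real_of_int (int p)"
      by (simp_all only: of_int_le_iff of_int_0_le_iff)
    then show ?thesis using assms by (simp add: divide_le_eq)
  qed
  then show ?thesis unfolding unit_cube_def by auto
qed

text \<open>Reduction modulo \<open>p\<close> changes the phase by an integer multiple of a full
  turn; \<open>q\<close> collects these integers.\<close>

lemma harmonic_lattice_node:
  assumes "p > 0"
  shows "harmonic d h (\<lambda>j\<in>{1..d}. real_of_int ((int k * z j) mod int p) / real p)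
       = exp (2 * of_real pi * \<i> * of_real (real_of_int (\<Sum>j=1..d. h j * z j) / real p)) ^ k"
proof -
  define m where "m = (\<Sum>j=1..d. h j * z j)"
  define q where "q = (\<Sum>j=1..d. h j * ((int k * z j) div int p))"
  have "real_of_int (h j) * (real_of_int ((int k * z j) mod int p) / real p)
      = real k * (real_of_int (h j * z j) / real p) - real_of_int (h j * ((int k * z j) div int p))" for j
    using assms unfolding minus_div_mult_eq_mod[symmetric] by (simp add: field_simps)
  then have "(\<Sum>j=1..d. real_of_int (h j) * (\<lambda>j\<in>{1..d}. real_of_int ((int k * z j) mod int p) / real p) j)
      = (\<Sum>j=1..d. real k * (real_of_int (h j * z j) / real p) - real_of_int (h j * ((int k * z j) div int p)))"
    by (intro sum.cong) auto
  also have "\<dots> = real k * (real_of_int m / real p) - real_of_int q"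
    by (simp add: sum_subtractf m_def q_def sum_distrib_left sum_divide_distrib)
  finally have "harmonic d h (\<lambda>j\<in>{1..d}. real_of_int ((int k * z j) mod int p) / real p)
      = exp (2 * of_real pi * \<i> * of_real (real k * (real_of_int m / real p) - real_of_int q))"
    unfolding harmonic_def by (simp only:)
  also have "\<dots> = exp (of_nat k * (2 * of_real pi * \<i> * of_real (real_of_int m / real p)) + 2 * of_real pi * \<i> * of_int (- q))"
    by (intro arg_cong[where f = exp]) (simp add: algebra_simps)
  also have "exp (of_nat k * (2 * of_real pi * \<i> * of_real (real_of_int m / real p)) + 2 * of_real pi * \<i> * of_int (- q))
      = exp (2 * of_real pi * \<i> * of_real (real_of_int m / real p)) ^ k * exp (2 * of_real pi * \<i> * of_int (- q))"
    by (simp only: exp_add exp_of_nat_mult)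
  also have "exp (2 * of_real pi * \<i> * of_int (- q)) = 1"
    unfolding exp_eq_1 by (auto intro!: exI[of _ "- q"])
  finally show ?thesis unfolding m_def mult_1_right .
qed

text \<open>The base \<open>w\<close> is a \<open>p\<close>-th root of unity. It is 1 exactly when
  \<open>p\<close> divides \<open>m\<close>; otherwise the geometric sum vanishes.\<close>

lemma mean_roots_of_unity:
  fixes m :: int
  assumes "p > 0"
  shows "1 / of_nat p * (\<Sum>k<p. exp (2 * of_real pi * \<i> * of_real (real_of_int m / real p)) ^ k)
       = (of_bool ([m = 0] (mod int p)) :: complex)"
proof -
  define w :: complex where "w = exp (2 * of_real pi * \<i> * of_real (real_of_int m / real p))"
  have "w ^ p = exp (2 * of_real pi * \<i> * of_int m)"
    using assms unfolding w_def exp_of_nat_mult[symmetric] by (intro arg_cong[where f = exp]) simp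
  also have "\<dots> = 1" unfolding exp_eq_1 by (auto intro!: exI[of _ m])
  finally have wp: "w ^ p = 1" .
  have "w = 1 \<longleftrightarrow> (\<exists>n::int. real_of_int m / real p = real_of_int n)"
  proof -
    have "2 * pi * x = real_of_int (2 * n) * pi \<longleftrightarrow> x = real_of_int n" for x :: real and n
      by (simp add: mult.commute mult.left_commute)
    moreover have "Re (2 * of_real pi * \<i> * of_real (real_of_int m / real p)) = 0"
      "Im (2 * of_real pi * \<i> * of_real (real_of_int m / real p)) = 2 * pi * (real_of_int m / real p)"
      by simp_all
    ultimately show ?thesis unfolding w_def exp_eq_1 by (simp only: simp_thms)
  qed
  also have "\<dots> \<longleftrightarrow> (\<exists>n. m = int p * n)"
  proof (intro arg_cong[where f = Ex] ext)
    fix n :: int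
    have "real_of_int m / real p = real_of_int n \<longleftrightarrow> real_of_int m = real_of_int (int p * n)"
      using assms by (simp add: divide_eq_eq mult.commute)
    then show "(real_of_int m / real p = real_of_int n) = (m = int p * n)"
      by (simp only: of_int_eq_iff)
  qed
  finally have w1: "w = 1 \<longleftrightarrow> [m = 0] (mod int p)"
    unfolding cong_0_iff dvd_def .
  show ?thesis
  proof (cases "w = 1")
    case True
    then show ?thesis using w1 assms unfolding w_def[symmetric] by simp
  next
    case False
    then have "(\<Sum>k<p. w ^ k) = 0" using wp by (simp add: geometric_sum)
    then show ?thesis using w1 False unfolding w_def[symmetric] by simp
  qed
qed

lemma has_sum_finite_sum:
  fixes f :: "'i \<Rightarrow> 'a \<Rightarrow> 'b :: topological_comm_monoid_add"
  assumes "finite I" "\<And>i. i \<in> I \<Longrightarrow> (f i has_sum s i) A"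
  shows "((\<lambda>x. \<Sum>i\<in>I. f i x) has_sum (\<Sum>i\<in>I. s i)) A"
  using assms by (induction I) (auto intro!: has_sum_add has_sum_0)

text \<open>Fourier inversion holds at each node; the finite mean over nodes moves inside the series
  and turns every harmonic into the indicator of the dual lattice.\<close>

lemma lattice_rule_has_sum:
  assumes p: "p > 0" and f: "continuous_on (unit_cube d) f"
    and c: "(\<lambda>h. cmod (fourier_coeff d f h)) summable_on int_vecs d"
  shows "((\<lambda>h. of_bool ([(\<Sum>j=1..d. h j * z j) = 0] (mod int p)) * fourier_coeff d f h)
            has_sum lattice_rule d p z f) (int_vecs d)"
proof -
  let ?c = "fourier_coeff d f"
  let ?x = "\<lambda>k. \<lambda>j\<in>{1..d}. real_of_int ((int k * z j) mod int p) / real p"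
  have "((\<lambda>h. ?c h * harmonic d h (?x k)) has_sum f (?x k)) (int_vecs d)" for k
    unfolding fourier_inversion[OF f c lattice_node_in_unit_cube[OF p]]
    by (rule fourier_series_has_sum[OF c])
  then have "((\<lambda>h. 1 / of_nat p * (\<Sum>k<p. ?c h * harmonic d h (?x k)))
      has_sum (1 / of_nat p * (\<Sum>k<p. f (?x k)))) (int_vecs d)"
    by (intro has_sum_cmult_right has_sum_finite_sum) auto
  moreover have "1 / of_nat p * (\<Sum>k<p. ?c h * harmonic d h (?x k))
      = of_bool ([(\<Sum>j=1..d. h j * z j) = 0] (mod int p)) * ?c h" for h
    unfolding mean_roots_of_unity[OF p, symmetric] harmonic_lattice_node[OF p]
    by (simp add: sum_distrib_left mult_ac)
  ultimately show ?thesis by (simp add: lattice_rule_def)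
qed

text \<open>The zero frequency lies in every dual lattice and its term is exactly the
  integral.\<close>

lemma lattice_error_has_sum:
  assumes p: "p > 0" and f: "continuous_on (unit_cube d) f"
    and c: "(\<lambda>h. cmod (fourier_coeff d f h)) summable_on int_vecs d"
  shows "((\<lambda>h. of_bool ([(\<Sum>j=1..d. h j * z j) = 0] (mod int p)) * fourier_coeff d f h)
            has_sum (lattice_rule d p z f - cube_integral d f)) (int_vecs d - {zero_vec d})"
proof (rule has_sum_Diff[OF lattice_rule_has_sum[OF assms]])
  have "fourier_coeff d f (zero_vec d) = cube_integral d f"
    unfolding fourier_coeff_eq cube_integral_eq by (subst harmonic_0) (auto simp: zero_vec_def)
  moreover have "(\<Sum>j=1..d. zero_vec d j * z j) = 0" by (simp add: zero_vec_def)
  ultimately show "((\<lambda>h. of_bool ([(\<Sum>j=1..d. h j * z j) = 0] (mod int p)) * fourier_coeff d f h)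
      has_sum cube_integral d f) {zero_vec d}"
    by (simp add: has_sum_finite_iff)
  show "{zero_vec d} \<subseteq> int_vecs d" by (auto simp: zero_vec_def int_vecs_def)
qed

section \<open>The randomised error\<close>

lemma finite_prime_range: "finite (prime_range n)"
  unfolding prime_range_def by (rule finite_subset[of _ "{..n}"]) auto

lemma prime_range_pos: "p \<in> prime_range n \<Longrightarrow> p > 0"
  unfolding prime_range_def by (auto simp: prime_gt_0_nat)

lemma omega_nonneg: "0 \<le> omega d n h z"
  unfolding omega_def by (intro mult_nonneg_nonneg sum_nonneg) auto

lemma omega_le_1: "omega d n h z \<le> 1"
proof -
  have "(\<Sum>p\<in>prime_range n. of_bool ([(\<Sum>j=1..d. h j * z j) = 0] (mod int p))) \<le> (\<Sum>p\<in>prime_range n. 1 :: real)"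
    by (intro sum_mono) auto
  \<comment> \<open>For a cardinality of 0 the division yields 0, which satisfies the bound.\<close>
  then show ?thesis
    unfolding omega_def by (cases "card (prime_range n) = 0") (auto simp: divide_le_eq)
qed

text \<open>The expected error as a real number, which keeps the estimates out of
  \<open>ennreal\<close>.\<close>

definition mean_error ::
  "nat \<Rightarrow> nat \<Rightarrow> (nat \<Rightarrow> int) \<Rightarrow> ((nat \<Rightarrow> real) \<Rightarrow> complex) \<Rightarrow> real" where
  "mean_error d n z f = 1 / real (card (prime_range n)) *
     (\<Sum>p\<in>prime_range n. cmod (lattice_rule d p z f - cube_integral d f))"

lemma nn_integral_ran_prime_rule:
  "(\<integral>\<^sup>+p. ennreal (cmod (snd (ran_prime_rule d n z) p f - cube_integral d f)) \<partial>fst (ran_prime_rule d n z))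
     = ennreal (mean_error d n z f)"
proof -
  have "(\<integral>\<^sup>+p. ennreal (cmod (snd (ran_prime_rule d n z) p f - cube_integral d f)) \<partial>fst (ran_prime_rule d n z))
     = (\<Sum>p\<in>prime_range n. ennreal (1 / real (card (prime_range n))) *
          ennreal (cmod (lattice_rule d p z f - cube_integral d f)))"
    unfolding ran_prime_rule_def uniform_count_measure_def fst_conv snd_conv
    by (subst nn_integral_point_measure_finite[OF finite_prime_range]) (simp add: ennreal_of_nat_eq_real_of_nat)
  also have "\<dots> = (\<Sum>p\<in>prime_range n. ennreal (1 / real (card (prime_range n)) *
          cmod (lattice_rule d p z f - cube_integral d f)))"
    by (intro sum.cong refl ennreal_mult[symmetric]) auto
  also have "\<dots> = ennreal (mean_error d n z f)"
    unfolding mean_error_def sum_distrib_left by (intro sum_ennreal) auto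
  finally show ?thesis .
qed

text \<open>Without absolute values the mean over primes is an exact series, since averaging the
  dual lattice indicators gives \<open>omega\<close>. This drives the lower bound.\<close>

lemma mean_signed_error_has_sum:
  assumes f: "continuous_on (unit_cube d) f"
    and c: "(\<lambda>h. cmod (fourier_coeff d f h)) summable_on int_vecs d"
  shows "((\<lambda>h. of_real (omega d n h z) * fourier_coeff d f h)
            has_sum (1 / of_nat (card (prime_range n)) *
              (\<Sum>p\<in>prime_range n. lattice_rule d p z f - cube_integral d f))) (int_vecs d - {zero_vec d})"
proof -
  let ?b = "\<lambda>p h. of_bool ([(\<Sum>j=1..d. h j * z j) = 0] (mod int p))"
  have "((\<lambda>h. 1 / of_nat (card (prime_range n)) * (\<Sum>p\<in>prime_range n. ?b p h * fourier_coeff d f h))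
            has_sum (1 / of_nat (card (prime_range n)) *
              (\<Sum>p\<in>prime_range n. lattice_rule d p z f - cube_integral d f))) (int_vecs d - {zero_vec d})"
    by (intro has_sum_cmult_right has_sum_finite_sum finite_prime_range lattice_error_has_sum f c prime_range_pos)
  moreover have "complex_of_real (of_bool P) = of_bool P" for P by (cases P) auto
  then have "1 / of_nat (card (prime_range n)) * (\<Sum>p\<in>prime_range n. ?b p h * fourier_coeff d f h)
      = of_real (omega d n h z) * fourier_coeff d f h" for h
    unfolding omega_def by (simp add: sum_distrib_right)
  ultimately show ?thesis by simp
qed

lemma mean_error_le_infsum:
  assumes f: "continuous_on (unit_cube d) f"
    and c: "(\<lambda>h. cmod (fourier_coeff d f h)) summable_on int_vecs d"
  shows "mean_error d n z f \<le> (\<Sum>\<^sub>\<infinity>h\<in>int_vecs d - {zero_vec d}. omega d n h z * cmod (fourier_coeff d f h))"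
proof -
  let ?b = "\<lambda>p h. of_bool ([(\<Sum>j=1..d. h j * z j) = 0] (mod int p)) :: real"
  let ?A = "int_vecs d - {zero_vec d}"
  let ?c = "\<lambda>h. cmod (fourier_coeff d f h)"
  have cA: "?c summable_on ?A" by (rule summable_on_subset_banach[OF c]) auto
  have sum: "(\<lambda>h. ?b p h * ?c h) summable_on ?A" for p
    by (rule summable_on_comparison_test[OF cA]) auto
  have "cmod (lattice_rule d p z f - cube_integral d f) \<le> (\<Sum>\<^sub>\<infinity>h\<in>?A. ?b p h * ?c h)" if "p \<in> prime_range n" for p
    by (rule norm_infsum_le[OF lattice_error_has_sum[OF prime_range_pos[OF that] f c] has_sum_infsum[OF sum]])
       (simp add: norm_mult)
  then have "mean_error d n z f \<le> 1 / real (card (prime_range n)) * (\<Sum>p\<in>prime_range n. \<Sum>\<^sub>\<infinity>h\<in>?A. ?b p h * ?c h)"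
    unfolding mean_error_def by (intro mult_left_mono sum_mono) auto
  \<comment> \<open>Here \<open>\<dots>\<close> is the average of series just obtained; exhibiting
    it as the value of one series moves the mean inside.\<close>
  also have "((\<lambda>h. 1 / real (card (prime_range n)) * (\<Sum>p\<in>prime_range n. ?b p h * ?c h))
      has_sum \<dots>) ?A"
    by (intro has_sum_cmult_right has_sum_finite_sum finite_prime_range has_sum_infsum sum)
  then have "1 / real (card (prime_range n)) * (\<Sum>p\<in>prime_range n. \<Sum>\<^sub>\<infinity>h\<in>?A. ?b p h * ?c h)
      = (\<Sum>\<^sub>\<infinity>h\<in>?A. 1 / real (card (prime_range n)) * (\<Sum>p\<in>prime_range n. ?b p h * ?c h))"
    by (rule infsumI[symmetric])
  also have "\<dots> = (\<Sum>\<^sub>\<infinity>h\<in>?A. omega d n h z * ?c h)"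
    unfolding omega_def by (intro infsum_cong) (simp add: sum_distrib_right)
  finally show ?thesis .
qed

lemma omega_korobov_summable:
  assumes "\<alpha> > 1 / 2"
  shows "(\<lambda>h. (omega d n h z)\<^sup>2 * korobov_r d \<alpha> \<gamma> h powi (-2)) summable_on (int_vecs d - {zero_vec d})"
proof (rule summable_on_comparison_test)
  show "(\<lambda>h. korobov_r d \<alpha> \<gamma> h powi (-2)) summable_on (int_vecs d - {zero_vec d})"
    by (rule summable_on_subset_banach[OF korobov_r_powi_summable[OF assms]]) auto
next
  fix h
  have nn: "0 \<le> korobov_r d \<alpha> \<gamma> h powi (-2)" by (simp add: power_int_minus)
  have "(omega d n h z)\<^sup>2 \<le> 1" using omega_nonneg omega_le_1 by (intro power_le_one)
  then show "(omega d n h z)\<^sup>2 * korobov_r d \<alpha> \<gamma> h powi (-2) \<le> korobov_r d \<alpha> \<gamma> h powi (-2)"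
    using mult_right_mono[OF _ nn] by fastforce
  show "0 \<le> (omega d n h z)\<^sup>2 * korobov_r d \<alpha> \<gamma> h powi (-2)" using nn by simp
qed

lemma continuous_on_korobov_space:
  "f \<in> korobov_space d \<alpha> \<gamma> \<Longrightarrow> continuous_on (unit_cube d) f"
  unfolding korobov_space_def using unit_cube_subset_real_vecs continuous_on_subset by blast

text \<open>Cauchy-Schwarz for the factors \<open>?\<omega> h / ?r h\<close> and
  \<open>?r h * ?c h\<close>, on finite sets of frequencies first; the uniform bound then passes to
  the series.\<close>

lemma mean_error_le:
  assumes \<alpha>: "\<alpha> > 1 / 2" and \<gamma>: "positive_weights \<gamma>"
    and f: "f \<in> korobov_space d \<alpha> \<gamma>" and norm: "korobov_norm d \<alpha> \<gamma> f \<le> 1"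
  shows "mean_error d n z f \<le> sqrt (\<Sum>\<^sub>\<infinity>h\<in>int_vecs d - {zero_vec d}. (omega d n h z)\<^sup>2 * korobov_r d \<alpha> \<gamma> h powi (-2))"
    (is "_ \<le> sqrt ?S")
proof -
  let ?A = "int_vecs d - {zero_vec d}" and ?c = "\<lambda>h. cmod (fourier_coeff d f h)"
    and ?r = "korobov_r d \<alpha> \<gamma>" and ?\<omega> = "\<lambda>h. omega d n h z"
  note f' = continuous_on_korobov_space[OF f]
  note c = korobov_space_coeff_summable[OF \<alpha> \<gamma> f]
  have r: "?r h > 0" for h by (rule korobov_r_pos[OF \<gamma>])
  have cA: "?c summable_on ?A" by (rule summable_on_subset_banach[OF c]) auto
  have le: "(\<Sum>h\<in>F. ?\<omega> h * ?c h) \<le> sqrt ?S" if F: "finite F" "F \<subseteq> ?A" for F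
  proof -
    have "(\<Sum>h\<in>F. ?\<omega> h * ?c h) = (\<Sum>h\<in>F. \<bar>?\<omega> h / ?r h\<bar> * \<bar>?r h * ?c h\<bar>)"
    proof (intro sum.cong refl)
      fix h show "?\<omega> h * ?c h = \<bar>?\<omega> h / ?r h\<bar> * \<bar>?r h * ?c h\<bar>"
        using r[of h] omega_nonneg[of d n h z] by (simp add: abs_mult)
    qed
    also have "\<dots> \<le> L2_set (\<lambda>h. ?\<omega> h / ?r h) F * L2_set (\<lambda>h. ?r h * ?c h) F"
      by (rule L2_set_mult_ineq)
    also have "\<dots> \<le> sqrt ?S * 1"
    proof (rule mult_mono)
      have "(\<Sum>h\<in>F. (?\<omega> h / ?r h)\<^sup>2) = (\<Sum>h\<in>F. (?\<omega> h)\<^sup>2 * ?r h powi (-2))"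
        by (intro sum.cong refl) (simp add: power_int_minus divide_inverse power_mult_distrib power_inverse)
      also have "\<dots> \<le> ?S"
        using F by (intro finite_sum_le_infsum omega_korobov_summable \<alpha>) (auto simp: power_int_minus)
      finally show "L2_set (\<lambda>h. ?\<omega> h / ?r h) F \<le> sqrt ?S" unfolding L2_set_def by simp
      have "(\<Sum>h\<in>F. (?r h * ?c h)\<^sup>2) = (\<Sum>h\<in>F. (?r h)\<^sup>2 * (?c h)\<^sup>2)" by (simp add: power_mult_distrib)
      also have "\<dots> \<le> (\<Sum>\<^sub>\<infinity>h\<in>int_vecs d. (?r h)\<^sup>2 * (?c h)\<^sup>2)"
        using F f by (intro finite_sum_le_infsum) (auto simp: korobov_space_def)
      finally have "L2_set (\<lambda>h. ?r h * ?c h) F \<le> korobov_norm d \<alpha> \<gamma> f"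
        unfolding L2_set_def korobov_norm_def by simp
      then show "L2_set (\<lambda>h. ?r h * ?c h) F \<le> 1" using norm by simp
    qed (auto intro!: infsum_nonneg simp: power_int_minus)
    finally show ?thesis by simp
  qed
  have "(\<lambda>h. ?\<omega> h * ?c h) summable_on ?A"
    by (rule summable_on_comparison_test[OF cA])
      (use omega_nonneg omega_le_1 in \<open>auto intro: mult_left_le_one_le\<close>)
  then have "(\<Sum>\<^sub>\<infinity>h\<in>?A. ?\<omega> h * ?c h) \<le> sqrt ?S"
    by (rule infsum_le_finite_sums) (rule le)
  then show ?thesis using mean_error_le_infsum[OF f' c, of n z] by linarith
qed

text \<open>The equality case of Cauchy-Schwarz, realised by a function given through its Fourier
  coefficients.\<close>

lemma mean_error_extremal:
  assumes \<alpha>: "\<alpha> > 1 / 2" and \<gamma>: "positive_weights \<gamma>"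
    and pos: "0 < (\<Sum>\<^sub>\<infinity>h\<in>int_vecs d - {zero_vec d}. (omega d n h z)\<^sup>2 * korobov_r d \<alpha> \<gamma> h powi (-2))" (is "0 < ?S")
  shows "\<exists>f\<in>korobov_space d \<alpha> \<gamma>. korobov_norm d \<alpha> \<gamma> f \<le> 1 \<and> sqrt ?S \<le> mean_error d n z f"
proof -
  let ?A = "int_vecs d - {zero_vec d}" and ?r = "korobov_r d \<alpha> \<gamma>" and ?\<omega> = "\<lambda>h. omega d n h z"
  \<comment> \<open>Division by \<open>sqrt ?S\<close> normalises the norm to 1, and the zero
    frequency, which does not affect the error, is left out.\<close>
  define c where "c h = (if h = zero_vec d then 0 else ?\<omega> h * ?r h powi (-2) / sqrt ?S)" for h
  define f where "f = fourier_series d (\<lambda>h. complex_of_real (c h))"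
  have r: "?r h > 0" for h by (rule korobov_r_pos[OF \<gamma>])
  have S: "((\<lambda>h. (?\<omega> h)\<^sup>2 * ?r h powi (-2)) has_sum ?S) ?A"
    by (rule has_sum_infsum[OF omega_korobov_summable[OF \<alpha>]])
  have c_nonneg: "0 \<le> c h" for h
    unfolding c_def using pos omega_nonneg by (auto simp: power_int_minus)
  have c_sum: "(\<lambda>h. cmod (complex_of_real (c h))) summable_on int_vecs d"
  proof (rule summable_on_comparison_test)
    show "(\<lambda>h. 1 / sqrt ?S * ?r h powi (-2)) summable_on int_vecs d"
      by (intro summable_on_cmult_right korobov_r_powi_summable \<alpha>)
    fix h
    have "?\<omega> h * ?r h powi (-2) \<le> 1 * ?r h powi (-2)"
      by (intro mult_right_mono omega_le_1) (simp add: power_int_minus)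
    then have "c h \<le> 1 / sqrt ?S * ?r h powi (-2)"
      unfolding c_def using pos by (auto simp: divide_right_mono power_int_minus)
    then show "cmod (complex_of_real (c h)) \<le> 1 / sqrt ?S * ?r h powi (-2)"
      using c_nonneg[of h] by simp
  qed simp
  have cont: "continuous_on B f" for B
    unfolding f_def by (rule continuous_on_fourier_series[OF c_sum])
  have coeff: "fourier_coeff d f h = complex_of_real (c h)" if "h \<in> int_vecs d" for h
    unfolding f_def by (rule fourier_coeff_fourier_series[OF c_sum that])
  have coeff_sum: "(\<lambda>h. cmod (fourier_coeff d f h)) summable_on int_vecs d"
    using c_sum by (subst summable_on_cong[OF arg_cong[where f = cmod, OF coeff]])
  have "((\<lambda>h. (?r h)\<^sup>2 * (cmod (fourier_coeff d f h))\<^sup>2) has_sum 1 / ?S * ?S) (int_vecs d)"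
  proof (subst has_sum_cong_neutral[where T = ?A and g = "\<lambda>h. 1 / ?S * ((?\<omega> h)\<^sup>2 * ?r h powi (-2))"])
    fix h assume "h \<in> int_vecs d \<inter> ?A"
    then have "cmod (fourier_coeff d f h) = c h" and "c h = ?\<omega> h * inverse ((?r h)\<^sup>2) / sqrt ?S"
      using c_nonneg[of h] by (simp add: coeff, simp add: c_def power_int_minus)
    moreover have "\<rho>\<^sup>2 * (w * inverse (\<rho>\<^sup>2) / sqrt s)\<^sup>2 = 1 / s * (w\<^sup>2 * inverse (\<rho>\<^sup>2))"
      if "0 < \<rho>" "0 < s" for \<rho> w s :: real
      using that by (simp add: power_divide power_mult_distrib field_simps power2_eq_square)
    ultimately show "(?r h)\<^sup>2 * (cmod (fourier_coeff d f h))\<^sup>2 = 1 / ?S * ((?\<omega> h)\<^sup>2 * ?r h powi (-2))"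
      using r[of h] pos by (simp add: power_int_minus)
  next
    show "((\<lambda>h. 1 / ?S * ((?\<omega> h)\<^sup>2 * ?r h powi (-2))) has_sum 1 / ?S * ?S) ?A"
      by (rule has_sum_cmult_right[OF S])
  qed (auto simp: coeff c_def)
  then have coeff_has_sum: "((\<lambda>h. (?r h)\<^sup>2 * (cmod (fourier_coeff d f h))\<^sup>2) has_sum 1) (int_vecs d)"
    using pos by simp
  have "f \<in> korobov_space d \<alpha> \<gamma>"
    unfolding korobov_space_def
    using cont square_integrable_cube_continuous[OF cont] one_periodic_fourier_series[of d] coeff_has_sum
    by (auto simp: f_def summable_on_def)
  moreover have "korobov_norm d \<alpha> \<gamma> f \<le> 1"
    unfolding korobov_norm_def infsumI[OF coeff_has_sum] by simp
  moreover have "sqrt ?S \<le> mean_error d n z f"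
  proof -
    let ?m = "1 / of_nat (card (prime_range n)) * (\<Sum>p\<in>prime_range n. lattice_rule d p z f - cube_integral d f)"
    \<comment> \<open>The same series is evaluated twice: as the mean signed error of
      \<open>f\<close>, and as \<open>?S / sqrt ?S\<close>.\<close>
    have "((\<lambda>h. complex_of_real (1 / sqrt ?S * ((?\<omega> h)\<^sup>2 * ?r h powi (-2)))) has_sum ?m) ?A"
    proof (subst has_sum_cong)
      fix h assume h: "h \<in> ?A"
      show "complex_of_real (1 / sqrt ?S * ((?\<omega> h)\<^sup>2 * ?r h powi (-2))) = of_real (?\<omega> h) * fourier_coeff d f h"
        using h by (simp add: coeff c_def power2_eq_square)
    qed (rule mean_signed_error_has_sum[OF cont coeff_sum])
    moreover have "((\<lambda>h. complex_of_real (1 / sqrt ?S * ((?\<omega> h)\<^sup>2 * ?r h powi (-2))))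
        has_sum complex_of_real (1 / sqrt ?S * ?S)) ?A"
      by (intro has_sum_of_real has_sum_cmult_right S)
    ultimately have "?m = complex_of_real (1 / sqrt ?S * ?S)" by (rule has_sum_unique)
    also have "1 / sqrt ?S * ?S = sqrt ?S" using pos by (simp add: real_div_sqrt)
    finally have "sqrt ?S = cmod ?m" using pos by simp
    \<comment> \<open>The modulus of a mean is at most the mean of the moduli, which is the
      direction the lower bound needs.\<close>
    also have "\<dots> \<le> mean_error d n z f"
      unfolding mean_error_def norm_mult by (intro mult_mono norm_sum) (auto simp: norm_divide intro: sum_nonneg)
    finally show ?thesis .
  qed
  ultimately show ?thesis by blast
qed

text \<open>Summability is asserted alongside the equation because a divergent \<open>infsum\<close>
  would have the default value 0.\<close>

theorem proposition3p1:
  fixes d n :: nat and \<alpha> :: real and \<gamma> :: "nat set \<Rightarrow> real" and z :: "nat \<Rightarrow> int"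
  assumes "d \<ge> 1" and "\<alpha> > 1 / 2" and "positive_weights \<gamma>" and "n \<ge> 2" and "z \<in> int_vecs d"
  shows "(\<lambda>h. (omega d n h z)\<^sup>2 * korobov_r d \<alpha> \<gamma> h powi (-2)) summable_on
           (int_vecs d - {zero_vec d}) \<and>
         randomised_error d \<alpha> \<gamma> (ran_prime_rule d n z) =
           ennreal (sqrt (\<Sum>\<^sub>\<infinity>h\<in>int_vecs d - {zero_vec d}.
             (omega d n h z)\<^sup>2 * korobov_r d \<alpha> \<gamma> h powi (-2)))"
    (is "?summable \<and> _ = ennreal (sqrt ?S)")
proof
  show ?summable by (rule omega_korobov_summable[OF assms(2)])
  show "randomised_error d \<alpha> \<gamma> (ran_prime_rule d n z) = ennreal (sqrt ?S)"
    unfolding randomised_error_def nn_integral_ran_prime_rule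
  proof (rule antisym)
    show "(SUP f\<in>{f \<in> korobov_space d \<alpha> \<gamma>. korobov_norm d \<alpha> \<gamma> f \<le> 1}. ennreal (mean_error d n z f))
        \<le> ennreal (sqrt ?S)"
      using mean_error_le[OF assms(2,3)] by (intro SUP_least ennreal_leI) auto
    show "ennreal (sqrt ?S)
        \<le> (SUP f\<in>{f \<in> korobov_space d \<alpha> \<gamma>. korobov_norm d \<alpha> \<gamma> f \<le> 1}. ennreal (mean_error d n z f))"
    proof (cases "0 < ?S")
      case True
      from mean_error_extremal[OF assms(2,3) this] obtain f where
        "f \<in> korobov_space d \<alpha> \<gamma>" "korobov_norm d \<alpha> \<gamma> f \<le> 1" "sqrt ?S \<le> mean_error d n z f" by blast
      then show ?thesis by (intro SUP_upper2[of f] ennreal_leI) auto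
    next
      case False
      \<comment> \<open>If \<open>?S\<close> is not positive, its square root is at most 0, which
        \<open>ennreal\<close> sends to 0.\<close>
      then show ?thesis by (simp add: ennreal_neg)
    qed
  qed
qed

end
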